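(* Let $(P_k)_{k\ge2}$ be Tahara's finite $2$-groups of nilpotency class three with the elements $h_k\in P_k$ (as specified in the context). Let $$P=\prod_{k\ge2}P_k,\qquad h=(h_k)_{k\ge2}\in P.$$ Equip $P$ with its lower central series and with the tower of finite subproducts $P\to P^{(j)}:=\prod_{2\le k\le j}P_k$ ($j\ge 2$), and let $D_4^{\rm fin}(P)$ be the finite-quotient saturation for this tower. Then $$h\in \bigl(\gamma_3(P)\cap D_4^{\rm fin}(P)\bigr)\setminus D_4(P).$$
   Context: Conventions: $[x,y]=xyx^{-1}y^{-1}$; $\gamma_s$ denotes the (abstract) lower central series; $\Delta(X)$ is the augmentation ideal of the abstract integral group ring $\mathbf Z[X]$; $D_m(X)=X\cap(1+\Delta(X)^m)$. For a group $X$, $A_m(X,\gamma_\bullet)\subseteq\mathbf Z[X]$ is the additive subgroup generated by products $(x_1-1)\cdots(x_r-1)$ with $x_\nu\in\gamma_{a_\nu}(X)$, $\sum a_\nu\ge m$. For the tower, $D_4^{\rm fin}(P)$ is the set of $x\in P$ whose image $x^{(j)}$ in $P^{(j)}$ satisfies $x^{(j)}-1\in A_4(P^{(j)},\gamma_\bullet)$ for every $j\ge 2$. Tahara's groups (K. Tahara, 1977, counterexample family on pp. 392--393, parameter $l=0$; their existence is Tahara's): for each $k\ge2$, $P_k$ is a finite $2$-group of nilpotency class three generated by four elements $x_{11},x_{12},x_{13},x_{14}$, with elements $x_{21},x_{22},x_{23},x_{24}\in\gamma_2(P_k)$, having the following structure. Put $T=2^{k+4}$. (1) $(P_k)_{\rm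 ab}\cong C_{2^k}e_1\oplus C_{2^{k+2}}e_2\oplus C_{2^{k+4}}e_3\oplus C_{2^{k+4}}e_4$, where $e_i$ is the class of $x_{1i}$; write $d(i)$ for the order of $e_i$. (2) $\gamma_3(P_k)=\langle z\rangle\cong C_T$, where $z=x_{21}^4$. (3) $\gamma_2(P_k)/\gamma_3(P_k)\cong C_4f_1\oplus C_{2^k}f_2\oplus C_{2^{k+2}}f_3\oplus C_{2^{k+4}}f_4$, where $f_j=x_{2j}\gamma_3(P_k)$. (4) With $p_i=x_{1i}^{d(i)}\gamma_3(P_k)\in\gamma_2(P_k)/\gamma_3(P_k)$, the $f_3$-coordinates of $p_1,p_2,p_3,p_4$ are $2^{k-2},0,2^k,0$ respectively. (5) The pair values $\rho_{ij}=[x_{1i}^{d(i)},x_{1j}]^{d(j)/d(i)}\in\gamma_3(P_k)$, $1\le i<j\le4$, are $\rho_{12}=z^{T/4}$, $\rho_{13}=z^{-T/2}$, $\rho_{23}=z^{-T/4}$ and $\rho_{14}=\rho_{24}=\rho_{34}=1$. (6) $h_k:=x_{24}^{2^{k+5}}=z^{T/2}$ lies in $D_4(P_k)\setminus\gamma_4(P_k)$. *)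

theory Defs
  imports "HOL-Algebra.Algebra"
begin

section \<open>Commutators and the lower central series\<close>

definition commutator :: "('a, 'b) monoid_scheme \<Rightarrow> 'a \<Rightarrow> 'a \<Rightarrow> 'a" where
  "commutator G x y = x \<otimes>\<^bsub>G\<^esub> y \<otimes>\<^bsub>G\<^esub> inv\<^bsub>G\<^esub> x \<otimes>\<^bsub>G\<^esub> inv\<^bsub>G\<^esub> y"

text \<open>
  The indexing starts at 1: \<open>lower_central G s\<close> is the \<open>s\<close>-th term for \<open>s \<ge> 1\<close>, and the value at 0
  is a dummy.
\<close>

fun lower_central :: "('a, 'b) monoid_scheme \<Rightarrow> nat \<Rightarrow> 'a set" where
  "lower_central G 0 = carrier G"
| "lower_central G (Suc 0) = carrier G"
| "lower_central G (Suc (Suc s)) =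
     generate G {commutator G x y | x y. x \<in> lower_central G (Suc s) \<and> y \<in> carrier G}"

lemma lower_central_2: "lower_central G 2 = derived G (carrier G)"
proof -
  have "{commutator G x y | x y. x \<in> carrier G \<and> y \<in> carrier G} = derived_set G (carrier G)"
    by (auto simp: commutator_def)
  then show ?thesis
    by (simp add: numeral_2_eq_2 derived_def)
qed

definition has_nilpotency_class :: "('a, 'b) monoid_scheme \<Rightarrow> nat \<Rightarrow> bool" where
  "has_nilpotency_class G c \<longleftrightarrow>
     lower_central G (Suc c) = {\<one>\<^bsub>G\<^esub>} \<and> (\<forall>b<c. lower_central G (Suc b) \<noteq> {\<one>\<^bsub>G\<^esub>})"


section \<open>Integral group rings and dimension subgroups\<close>

text \<open>
  The elements are the formal integer combinations supported on the carrier. The product is the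
  bilinear extension of the group multiplication.
\<close>

definition group_ring :: "('a, 'b) monoid_scheme \<Rightarrow> ('a \<Rightarrow>\<^sub>0 int) ring" where
  "group_ring G =
     \<lparr>carrier = {f. Poly_Mapping.keys f \<subseteq> carrier G},
      monoid.mult = (\<lambda>f g. frag_extend (\<lambda>x. frag_extend (\<lambda>y. frag_of (x \<otimes>\<^bsub>G\<^esub> y)) g) f),
      monoid.one = frag_of \<one>\<^bsub>G\<^esub>,
      ring.zero = 0,
      ring.add = (+)\<rparr>"

lemma group_ring_simps [simp]:
  "carrier (group_ring G) = {f. Poly_Mapping.keys f \<subseteq> carrier G}"
  "f \<otimes>\<^bsub>group_ring G\<^esub> g = frag_extend (\<lambda>x. frag_extend (\<lambda>y. frag_of (x \<otimes>\<^bsub>G\<^esub> y)) g) f"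
  "\<one>\<^bsub>group_ring G\<^esub> = frag_of \<one>\<^bsub>G\<^esub>"
  "\<zero>\<^bsub>group_ring G\<^esub> = 0"
  "f \<oplus>\<^bsub>group_ring G\<^esub> g = f + g"
  by (simp_all add: group_ring_def)

definition augmentation :: "('a \<Rightarrow>\<^sub>0 int) \<Rightarrow> int" where
  "augmentation f = (\<Sum>x\<in>Poly_Mapping.keys f. Poly_Mapping.lookup f x)"

definition augmentation_ideal :: "('a, 'b) monoid_scheme \<Rightarrow> ('a \<Rightarrow>\<^sub>0 int) set" where
  "augmentation_ideal G = {f \<in> carrier (group_ring G). augmentation f = 0}"

primrec augmentation_power :: "('a, 'b) monoid_scheme \<Rightarrow> nat \<Rightarrow> ('a \<Rightarrow>\<^sub>0 int) set" where
  "augmentation_power G 0 = carrier (group_ring G)"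
| "augmentation_power G (Suc m) =
     ideal_prod (group_ring G) (augmentation_ideal G) (augmentation_power G m)"

text \<open>The element \<open>x - 1\<close> of the group ring.\<close>

definition minus_one :: "('a, 'b) monoid_scheme \<Rightarrow> 'a \<Rightarrow> 'a \<Rightarrow>\<^sub>0 int" where
  "minus_one G x = frag_of x - frag_of \<one>\<^bsub>G\<^esub>"

definition dimension_subgroup :: "nat \<Rightarrow> ('a, 'b) monoid_scheme \<Rightarrow> 'a set" where
  "dimension_subgroup m G = {x \<in> carrier G. minus_one G x \<in> augmentation_power G m}"

text \<open>
  A list \<open>[(a\<^sub>1, x\<^sub>1), \<dots>, (a\<^sub>r, x\<^sub>r)]\<close> with \<open>a\<^sub>i \<ge> 1\<close> and \<open>x\<^sub>i\<close> in the \<open>a\<^sub>i\<close>-th term of the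
  filtration \<open>F\<close> stands for the product \<open>(x\<^sub>1 - 1) \<cdots> (x\<^sub>r - 1)\<close> of weight \<open>a\<^sub>1 + \<dots> + a\<^sub>r\<close>. The
  empty list has weight 0 and thus contributes only for \<open>m = 0\<close>.
\<close>

definition weighted_product :: "('a, 'b) monoid_scheme \<Rightarrow> (nat \<times> 'a) list \<Rightarrow> 'a \<Rightarrow>\<^sub>0 int" where
  "weighted_product G ps =
     foldr (\<lambda>(a, x) f. minus_one G x \<otimes>\<^bsub>group_ring G\<^esub> f) ps \<one>\<^bsub>group_ring G\<^esub>"

definition weight_filtration ::
    "nat \<Rightarrow> ('a, 'b) monoid_scheme \<Rightarrow> (nat \<Rightarrow> 'a set) \<Rightarrow> ('a \<Rightarrow>\<^sub>0 int) set" where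
  "weight_filtration m G F =
     generate (add_monoid (group_ring G))
       {weighted_product G ps | ps.
          (\<forall>(a, x)\<in>set ps. a \<ge> 1 \<and> x \<in> F a) \<and> sum_list (map fst ps) \<ge> m}"

text \<open>
  The finite-quotient saturation with respect to a tower of homomorphisms \<open>\<pi> j : P \<rightarrow> Q j\<close>,
  \<open>j \<in> J\<close>, each \<open>Q j\<close> carrying its own lower central series.
\<close>

definition fin_dimension_subgroup ::
    "nat \<Rightarrow> ('a, 'b) monoid_scheme \<Rightarrow> 'j set \<Rightarrow> ('j \<Rightarrow> ('c, 'd) monoid_scheme) \<Rightarrow>
     ('j \<Rightarrow> 'a \<Rightarrow> 'c) \<Rightarrow> 'a set" where
  "fin_dimension_subgroup m P J Q \<pi> =
     {x \<in> carrier P.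
        \<forall>j\<in>J. minus_one (Q j) (\<pi> j x) \<in> weight_filtration m (Q j) (lower_central (Q j))}"


subsection \<open>The group ring is a ring and the augmentation ideal is an ideal\<close>

lemma keys_frag_extend_in:
  assumes "Poly_Mapping.keys f \<subseteq> S" "\<And>x. x \<in> S \<Longrightarrow> Poly_Mapping.keys (b x) \<subseteq> T"
  shows "Poly_Mapping.keys (frag_extend b f) \<subseteq> T"
  using keys_frag_extend[of b f] assms by blast

lemma frag_extend_fun_diff:
  "frag_extend (\<lambda>x. b x - c x) f = frag_extend b f - frag_extend c f"
  using subset_UNIV[of "Poly_Mapping.keys f"]
  by (induction f rule: frag_induction) (auto simp: frag_extend_diff)

lemma frag_extend_fun_add:
  "frag_extend (\<lambda>x. b x + c x) f = frag_extend b f + frag_extend c f"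
  using subset_UNIV[of "Poly_Mapping.keys f"]
  by (induction f rule: frag_induction) (auto simp: frag_extend_diff)

lemma frag_extend_fun_0 [simp]: "frag_extend (\<lambda>x. 0) f = 0"
  by (simp add: frag_extend_eq_0)

lemma augmentation_superset:
  assumes "finite S" "Poly_Mapping.keys f \<subseteq> S"
  shows "augmentation f = (\<Sum>x\<in>S. Poly_Mapping.lookup f x)"
  unfolding augmentation_def using assms
  by (intro sum.mono_neutral_left) (auto simp: in_keys_iff)

lemma augmentation_0 [simp]: "augmentation 0 = 0"
  and augmentation_of [simp]: "augmentation (frag_of x) = 1"
  by (simp_all add: augmentation_def)

lemma augmentation_diff: "augmentation (f - g) = augmentation f - augmentation g"
proof -
  let ?S = "Poly_Mapping.keys f \<union> Poly_Mapping.keys g"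
  have "Poly_Mapping.keys (f - g) \<subseteq> ?S"
    by (rule keys_diff)
  then show ?thesis
    by (simp add: augmentation_superset[of ?S] lookup_minus sum_subtractf)
qed

lemma augmentation_add: "augmentation (f + g) = augmentation f + augmentation g"
  using augmentation_diff[of "f + g" g] by simp

lemma augmentation_group_ring_mult:
  "augmentation (f \<otimes>\<^bsub>group_ring G\<^esub> g) = augmentation f * augmentation g"
proof -
  have 1: "augmentation (frag_extend (\<lambda>y. frag_of (x \<otimes>\<^bsub>G\<^esub> y)) g) = augmentation g" for x
    using subset_UNIV[of "Poly_Mapping.keys g"]
    by (induction g rule: frag_induction)
       (auto simp: frag_extend_diff augmentation_diff)
  show ?thesis unfolding group_ring_simps
    using subset_UNIV[of "Poly_Mapping.keys f"]
    by (induction f rule: frag_induction)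
       (auto simp: frag_extend_diff augmentation_diff 1 left_diff_distrib)
qed

context group
begin

lemma group_ring_mult_closed:
  assumes "f \<in> carrier (group_ring G)" "g \<in> carrier (group_ring G)"
  shows "f \<otimes>\<^bsub>group_ring G\<^esub> g \<in> carrier (group_ring G)"
  using assms unfolding group_ring_simps mem_Collect_eq
  by (intro keys_frag_extend_in[where S = "carrier G"]) (auto simp: keys_frag_of)

lemma group_ring_mult_assoc:
  assumes "f \<in> carrier (group_ring G)" "g \<in> carrier (group_ring G)"
    "h \<in> carrier (group_ring G)"
  shows "f \<otimes>\<^bsub>group_ring G\<^esub> g \<otimes>\<^bsub>group_ring G\<^esub> h = f \<otimes>\<^bsub>group_ring G\<^esub> (g \<otimes>\<^bsub>group_ring G\<^esub> h)"
proof -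
  have h: "Poly_Mapping.keys h \<subseteq> carrier G"
    and g: "Poly_Mapping.keys g \<subseteq> carrier G"
    and f: "Poly_Mapping.keys f \<subseteq> carrier G"
    using assms by auto
  have 1: "frag_extend (\<lambda>z. frag_of (x \<otimes> y \<otimes> z)) h =
           frag_extend (\<lambda>z. frag_of (x \<otimes> z)) (frag_extend (\<lambda>z. frag_of (y \<otimes> z)) h)"
    if "x \<in> carrier G" "y \<in> carrier G" for x y
    using h that
    by (induction h rule: frag_induction) (auto simp: frag_extend_diff m_assoc)
  have 2: "frag_extend (\<lambda>y. frag_extend (\<lambda>z. frag_of (y \<otimes> z)) h)
             (frag_extend (\<lambda>y. frag_of (x \<otimes> y)) g) =
           frag_extend (\<lambda>z. frag_of (x \<otimes> z))
             (frag_extend (\<lambda>y. frag_extend (\<lambda>z. frag_of (y \<otimes> z)) h) g)"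
    if "x \<in> carrier G" for x
    using g that
    by (induction g rule: frag_induction) (auto simp: frag_extend_diff 1)
  show ?thesis unfolding group_ring_simps using f
    by (induction f rule: frag_induction) (auto simp: frag_extend_diff 2)
qed

lemma group_ring_is_ring: "ring (group_ring G)"
proof (rule ringI)
  show "abelian_group (group_ring G)"
  proof (rule abelian_groupI)
    fix f assume "f \<in> carrier (group_ring G)"
    then show "\<exists>g\<in>carrier (group_ring G). g \<oplus>\<^bsub>group_ring G\<^esub> f = \<zero>\<^bsub>group_ring G\<^esub>"
      by (intro bexI[of _ "- f"]) auto
  next
    fix f g assume "f \<in> carrier (group_ring G)" "g \<in> carrier (group_ring G)"
    then show "f \<oplus>\<^bsub>group_ring G\<^esub> g \<in> carrier (group_ring G)"
      using Poly_Mapping.keys_add[of f g] by auto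
  qed (simp_all add: add.assoc add.commute)
  show "monoid (group_ring G)"
  proof (rule monoidI)
    fix f assume "f \<in> carrier (group_ring G)"
    then have f: "Poly_Mapping.keys f \<subseteq> carrier G"
      by simp
    show "\<one>\<^bsub>group_ring G\<^esub> \<otimes>\<^bsub>group_ring G\<^esub> f = f"
      unfolding group_ring_simps frag_extend_of using f
      by (induction f rule: frag_induction) (auto simp: frag_extend_diff)
    show "f \<otimes>\<^bsub>group_ring G\<^esub> \<one>\<^bsub>group_ring G\<^esub> = f"
      unfolding group_ring_simps frag_extend_of using f
      by (induction f rule: frag_induction) (auto simp: frag_extend_diff)
  qed (fact group_ring_mult_closed, simp add: keys_frag_of, fact group_ring_mult_assoc)
qed (simp_all add: frag_extend_add frag_extend_fun_add)

lemma augmentation_ideal_is_ideal: "ideal (augmentation_ideal G) (group_ring G)"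
proof (rule idealI[OF group_ring_is_ring])
  interpret R: ring "group_ring G"
    by (rule group_ring_is_ring)
  have *: "\<ominus>\<^bsub>group_ring G\<^esub> f = - f" if "f \<in> carrier (group_ring G)" for f
    using that by (intro R.minus_equality) auto
  show "subgroup (augmentation_ideal G) (add_monoid (group_ring G))"
  proof (rule R.add.subgroupI)
    show "augmentation_ideal G \<subseteq> carrier (group_ring G)"
      by (auto simp: augmentation_ideal_def)
    show "augmentation_ideal G \<noteq> {}"
      by (auto simp: augmentation_ideal_def intro!: exI[of _ 0])
    show "\<ominus>\<^bsub>group_ring G\<^esub> f \<in> augmentation_ideal G" if "f \<in> augmentation_ideal G" for f
      using that * augmentation_diff[of 0 f] by (auto simp: augmentation_ideal_def)
    show "f \<oplus>\<^bsub>group_ring G\<^esub> g \<in> augmentation_ideal G"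
      if "f \<in> augmentation_ideal G" "g \<in> augmentation_ideal G" for f g
      using that R.a_closed[of f g] by (auto simp: augmentation_ideal_def augmentation_add)
  qed
qed (use group_ring_mult_closed in
      \<open>auto simp: augmentation_ideal_def augmentation_group_ring_mult simp del: group_ring_simps(2)\<close>)

end


section \<open>Internal direct sums of cyclic groups\<close>

text \<open>\<open>A\<close> is the direct sum of the cyclic groups \<open>C\<^bsub>n i\<^esub>\<close> generated by \<open>a i\<close>, \<open>i \<in> I\<close>.\<close>

definition cyclic_sum_map ::
    "('a, 'b) monoid_scheme \<Rightarrow> 'i set \<Rightarrow> ('i \<Rightarrow> 'a) \<Rightarrow> ('i \<Rightarrow> int) \<Rightarrow> 'a" where
  "cyclic_sum_map A I a = (\<lambda>m. \<Otimes>\<^bsub>A\<^esub>i\<in>I. a i [^]\<^bsub>A\<^esub> m i)"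

definition is_cyclic_sum ::
    "('a, 'b) monoid_scheme \<Rightarrow> 'i set \<Rightarrow> ('i \<Rightarrow> nat) \<Rightarrow> ('i \<Rightarrow> 'a) \<Rightarrow> bool" where
  "is_cyclic_sum A I n a \<longleftrightarrow>
     comm_group A \<and> a \<in> I \<rightarrow> carrier A \<and>
     cyclic_sum_map A I a \<in> iso (product_group I (\<lambda>i. integer_mod_group (n i))) A"

text \<open>
  The coordinates of \<open>p\<close> in such a decomposition; the \<open>i\<close>-th one is represented in \<open>{0..<n i}\<close>.
\<close>

definition cyclic_coords ::
    "('a, 'b) monoid_scheme \<Rightarrow> 'i set \<Rightarrow> ('i \<Rightarrow> nat) \<Rightarrow> ('i \<Rightarrow> 'a) \<Rightarrow> 'a \<Rightarrow> 'i \<Rightarrow> int" where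
  "cyclic_coords A I n a p =
     inv_into (carrier (product_group I (\<lambda>i. integer_mod_group (n i)))) (cyclic_sum_map A I a) p"


section \<open>Tahara's groups\<close>

definition abelianization :: "('a, 'b) monoid_scheme \<Rightarrow> 'a set monoid" where
  "abelianization G = G Mod derived G (carrier G)"

definition ab_class :: "('a, 'b) monoid_scheme \<Rightarrow> 'a \<Rightarrow> 'a set" where
  "ab_class G x = derived G (carrier G) #>\<^bsub>G\<^esub> x"

definition ab_order :: "('a, 'b) monoid_scheme \<Rightarrow> 'a \<Rightarrow> nat" where
  "ab_order G x = group.ord (abelianization G) (ab_class G x)"

definition gamma23 :: "('a, 'b) monoid_scheme \<Rightarrow> 'a set monoid" where
  "gamma23 G = (G\<lparr>carrier := lower_central G 2\<rparr>) Mod lower_central G 3"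

definition gamma3_class :: "('a, 'b) monoid_scheme \<Rightarrow> 'a \<Rightarrow> 'a set" where
  "gamma3_class G x = lower_central G 3 #>\<^bsub>G\<^esub> x"

definition pair_value :: "('a, 'b) monoid_scheme \<Rightarrow> 'a \<Rightarrow> 'a \<Rightarrow> 'a" where
  "pair_value G x y =
     commutator G (x [^]\<^bsub>G\<^esub> ab_order G x) y [^]\<^bsub>G\<^esub> (ab_order G y div ab_order G x)"

text \<open>
  The parameters \<open>x1 i\<close> and \<open>x2 i\<close>, \<open>i \<in> {1..4}\<close>, are the elements \<open>x\<^bsub>1i\<^esub>\<close> and \<open>x\<^bsub>2i\<^esub>\<close>;
  the element \<open>z\<close> is \<open>x2 1 [^] 4\<close>, and \<open>T\<close> is \<open>2 ^ (k + 4)\<close>. Lists of values are indexed by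
  \<open>i - 1\<close>.
\<close>

locale tahara_group = group G
  for G :: "('a, 'b) monoid_scheme" (structure) +
  fixes k :: nat and x1 x2 :: "nat \<Rightarrow> 'a" and z :: 'a and T :: nat
  defines "z \<equiv> x2 1 [^] (4::nat)" and "T \<equiv> 2 ^ (k + 4)"
  assumes k_ge_2: "2 \<le> k"
    and finite_carrier: "finite (carrier G)"
    and two_group: "\<exists>n. order G = 2 ^ n"
    and class_three: "has_nilpotency_class G 3"
    and x1_closed: "x1 ` {1..4} \<subseteq> carrier G"
    and x1_generate: "generate G (x1 ` {1..4}) = carrier G"
    and x2_gamma2: "x2 ` {1..4} \<subseteq> lower_central G 2"
    and ab_sum:
      "is_cyclic_sum (abelianization G) {1..4}
         (\<lambda>i. [2 ^ k, 2 ^ (k + 2), 2 ^ (k + 4), 2 ^ (k + 4)] ! (i - 1))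
         (\<lambda>i. ab_class G (x1 i))"
    and gamma3_generate: "lower_central G 3 = generate G {z}"
    and ord_z: "ord z = T"
    and gamma23_sum:
      "is_cyclic_sum (gamma23 G) {1..4}
         (\<lambda>j. [4, 2 ^ k, 2 ^ (k + 2), 2 ^ (k + 4)] ! (j - 1))
         (\<lambda>j. gamma3_class G (x2 j))"
    and power_gamma2: "\<And>i. i \<in> {1..4} \<Longrightarrow> x1 i [^] ab_order G (x1 i) \<in> lower_central G 2"
    and power_coord3:
      "\<And>i. i \<in> {1..4} \<Longrightarrow>
         cyclic_coords (gamma23 G) {1..4}
           (\<lambda>j. [4, 2 ^ k, 2 ^ (k + 2), 2 ^ (k + 4)] ! (j - 1))
           (\<lambda>j. gamma3_class G (x2 j))
           (gamma3_class G (x1 i [^] ab_order G (x1 i))) 3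
         = [2 ^ (k - 2), 0, 2 ^ k, 0] ! (i - 1)"
    and pair_values:
      "pair_value G (x1 1) (x1 2) = z [^] (T div 4)"
      "pair_value G (x1 1) (x1 3) = z [^] (- int (T div 2))"
      "pair_value G (x1 2) (x1 3) = z [^] (- int (T div 4))"
      "pair_value G (x1 1) (x1 4) = \<one>"
      "pair_value G (x1 2) (x1 4) = \<one>"
      "pair_value G (x1 3) (x1 4) = \<one>"
    and h_eq: "x2 4 [^] ((2::nat) ^ (k + 5)) = z [^] (T div 2)"
    and h_dim: "x2 4 [^] ((2::nat) ^ (k + 5)) \<in> dimension_subgroup 4 G - lower_central G 4"

end

theory Submission
  imports Defs
begin

text \<open>
  The group \<open>\<gamma>\<^sub>3(P\<^sub>k)\<close> is cyclic of order a power of 2, so some triple commutator generates it,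
  and \<open>h\<^sub>k\<close> is itself a triple commutator \<open>[[a\<^sub>k, b\<^sub>k], c\<^sub>k]\<close>; hence \<open>h \<in> \<gamma>\<^sub>3(P)\<close>. Finite subproducts
  only need that dimension subgroups are functorial.

  A function \<open>F : X \<rightarrow> \<real>/\<int>\<close> whose fourth differences vanish extends linearly to a functional on
  \<open>\<int>[X]\<close> killing \<open>\<Delta>(X)\<^sup>4\<close>, so \<open>F x = F 1\<close> for \<open>x \<in> D\<^sub>4(X)\<close>. On \<open>P\<^sub>k\<close> such a function cannot
  separate \<open>h\<^sub>k\<close> from 1. Take a character \<open>\<chi>\<close> of \<open>\<gamma>\<^sub>2(P\<^sub>k)\<close> with \<open>\<chi>(h\<^sub>k) \<noteq> 0\<close>. If the integer
  vector \<open>n\<close> gives the coordinates of \<open>g\<close> in \<open>(P\<^sub>k)\<^sub>a\<^sub>b\<close>, then \<open>\<chi>((x\<^sub>1\<^sub>1\<^bsup>n1\<^esup> \<cdots> x\<^sub>1\<^sub>4\<^bsup>n4\<^esup>)\<inverse> g)\<close> is cubic in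
  \<open>(g, n)\<close>. It can be corrected by a quadratic polynomial in \<open>n\<close> to be independent of the choice of
  \<open>n\<close>, except for a defect given by the pair values, which have order dividing 4. The defect can be
  repaired as soon as \<open>n mod 4\<close> lifts to a homomorphism to a cyclic group of much larger order. In
  the infinite product, an element of \<open>D\<^sub>4(P)\<close> only involves finitely many elements, so by the
  pigeonhole principle there are \<open>k\<close> and \<open>K \<ge> k + 6\<close> such that the coordinates modulo 4 of all of
  them at \<open>k\<close> and at \<open>K\<close> agree, and the coordinates at \<open>K\<close> provide the lift.
\<close>

section \<open>The circle group\<close>

\<comment> \<open>Characters take values in R/Z because it is divisible and has elements of every
  finite order: the first property supplies the roots used in \<open>tahara_character\<close>, the
  second the value 1/2 at \<open>h\<close>.\<close>
quotient_type circle = real / "\<lambda>x y :: real. x - y \<in> \<int>"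
proof (rule equivpI)
  show "symp (\<lambda>x y :: real. x - y \<in> \<int>)"
    by (rule sympI) (metis Ints_minus minus_diff_eq)
  show "transp (\<lambda>x y :: real. x - y \<in> \<int>)"
    by (rule transpI) (metis Ints_add diff_add_cancel add_diff_eq)
qed (simp add: reflp_def)

instantiation circle :: ab_group_add
begin

lift_definition zero_circle :: circle is 0 .
lift_definition plus_circle :: "circle \<Rightarrow> circle \<Rightarrow> circle" is "(+)"
  by (metis Ints_add add_diff_add)
lift_definition uminus_circle :: "circle \<Rightarrow> circle" is uminus
  by (metis Ints_minus minus_diff_minus)
lift_definition minus_circle :: "circle \<Rightarrow> circle \<Rightarrow> circle" is "(-)"
  by (metis Ints_diff diff_diff_eq2 diff_diff_add add.commute diff_add_eq)

instance
  by standard (transfer; simp)+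

end

lift_definition circle_of :: "real \<Rightarrow> circle" is "\<lambda>x. x" .

lift_definition zmul :: "int \<Rightarrow> circle \<Rightarrow> circle" (infixr "\<odot>\<^sub>z" 75) is "\<lambda>n x. of_int n * x"
  by (metis Ints_mult Ints_of_int right_diff_distrib)

lemma circle_of_eq_0_iff: "circle_of x = 0 \<longleftrightarrow> x \<in> \<int>"
  by transfer simp

lemma circle_of_add: "circle_of (x + y) = circle_of x + circle_of y"
  by transfer simp

lemma circle_of_diff: "circle_of (x - y) = circle_of x - circle_of y"
  by transfer simp

lemma zmul_add_left: "(m + n) \<odot>\<^sub>z t = m \<odot>\<^sub>z t + n \<odot>\<^sub>z t"
  by transfer (simp add: algebra_simps)

lemma zmul_diff_left: "(m - n) \<odot>\<^sub>z t = m \<odot>\<^sub>z t - n \<odot>\<^sub>z t"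
  by transfer (simp add: algebra_simps)

lemma zmul_add_right: "n \<odot>\<^sub>z (s + t) = n \<odot>\<^sub>z s + n \<odot>\<^sub>z t"
  by transfer (simp add: algebra_simps)

lemma zmul_zmul [simp]: "m \<odot>\<^sub>z n \<odot>\<^sub>z t = (m * n) \<odot>\<^sub>z t"
  by transfer (simp add: algebra_simps)

lemma zmul_0_left [simp]: "0 \<odot>\<^sub>z t = 0"
  by transfer simp

lemma zmul_0_right [simp]: "n \<odot>\<^sub>z 0 = 0"
  by transfer simp

lemma zmul_1 [simp]: "1 \<odot>\<^sub>z t = t"
  by transfer simp

lemma zmul_sum_right: "n \<odot>\<^sub>z sum f A = (\<Sum>i\<in>A. n \<odot>\<^sub>z f i)"
  by (induction A rule: infinite_finite_induct) (simp_all add: zmul_add_right)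

lemma zmul_eq_0_dvd:
  assumes "m \<odot>\<^sub>z t = 0" "m dvd n"
  shows "n \<odot>\<^sub>z t = 0"
  using assms by (metis dvdE mult.commute zmul_0_right zmul_zmul)

lemma zmul_divisible:
  assumes "n \<noteq> 0"
  obtains s where "n \<odot>\<^sub>z s = t"
proof -
  have "\<exists>s. n \<odot>\<^sub>z s = t"
    using assms
  proof (transfer, goal_cases)
    case (1 n t)
    then show ?case
      by (intro exI[of _ "t / of_int n"]) simp
  qed
  then show ?thesis
    using that by blast
qed


section \<open>Polynomial functions and powers of the augmentation ideal\<close>

lemma (in group) inv_mult_cancel:
  assumes "x \<in> carrier G" "y \<in> carrier G"
  shows "inv x \<otimes> (x \<otimes> y) = y" "x \<otimes> (inv x \<otimes> y) = y"
  using assms by (simp_all flip: m_assoc)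

text \<open>Polynomial maps of degree less than \<open>m\<close>, with only the zero map at
  \<open>m = 0\<close>. The strict bound makes the index match that of
  \<open>augmentation_power\<close>, and the left translations match left multiplication by x -
  1.\<close>

primrec poly_lt :: "('a, 'b) monoid_scheme \<Rightarrow> nat \<Rightarrow> ('a \<Rightarrow> circle) \<Rightarrow> bool" where
  "poly_lt G 0 F \<longleftrightarrow> (\<forall>x\<in>carrier G. F x = 0)"
| "poly_lt G (Suc m) F \<longleftrightarrow> (\<forall>x\<in>carrier G. poly_lt G m (\<lambda>y. F (x \<otimes>\<^bsub>G\<^esub> y) - F y))"

lemma poly_lt_SucI:
  assumes "\<And>x. x \<in> carrier G \<Longrightarrow> poly_lt G m (\<lambda>y. F (x \<otimes>\<^bsub>G\<^esub> y) - F y)"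
  shows "poly_lt G (Suc m) F"
  using assms by simp

context monoid
begin

lemma poly_lt_cong:
  assumes "\<And>x. x \<in> carrier G \<Longrightarrow> F x = F' x"
  shows "poly_lt G m F \<longleftrightarrow> poly_lt G m F'"
  using assms
proof (induction m arbitrary: F F')
  case (Suc m)
  have "poly_lt G m (\<lambda>y. F (x \<otimes> y) - F y) \<longleftrightarrow> poly_lt G m (\<lambda>y. F' (x \<otimes> y) - F' y)"
    if "x \<in> carrier G" for x
    by (rule Suc.IH) (simp add: Suc.prems that)
  then show ?case
    by simp
qed simp

lemma poly_lt_congI:
  assumes "poly_lt G m F" "\<And>x. x \<in> carrier G \<Longrightarrow> F' x = F x"
  shows "poly_lt G m F'"
  by (rule poly_lt_cong[THEN iffD1, OF assms(2)[symmetric] assms(1)])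

lemma poly_lt_0: "poly_lt G m (\<lambda>x. 0)"
  by (induction m) auto

lemma poly_lt_add:
  assumes "poly_lt G m F" "poly_lt G m F'"
  shows "poly_lt G m (\<lambda>x. F x + F' x)"
  using assms
proof (induction m arbitrary: F F')
  case (Suc m)
  have "poly_lt G m (\<lambda>y. (F (x \<otimes> y) - F y) + (F' (x \<otimes> y) - F' y))" if "x \<in> carrier G" for x
    using Suc that by auto
  then show ?case
    by (simp add: algebra_simps)
qed simp

lemma poly_lt_sum:
  assumes "\<And>i. i \<in> I \<Longrightarrow> poly_lt G m (F i)"
  shows "poly_lt G m (\<lambda>x. \<Sum>i\<in>I. F i x)"
  using assms
  by (induction I rule: infinite_finite_induct) (simp_all add: poly_lt_0 poly_lt_add)

lemma poly_lt_Suc: "poly_lt G m F \<Longrightarrow> poly_lt G (Suc m) F"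
  by (induction m arbitrary: F) auto

lemma poly_lt_mono:
  assumes "m \<le> n" "poly_lt G m F"
  shows "poly_lt G n F"
  using assms by (induction n rule: dec_induct) (simp_all add: poly_lt_Suc del: poly_lt.simps)

lemma poly_lt_const: "0 < m \<Longrightarrow> poly_lt G m (\<lambda>x. c)"
  by (cases m) (simp_all add: poly_lt_0)

lemma poly_lt_additive:
  assumes "\<And>x y. x \<in> carrier G \<Longrightarrow> y \<in> carrier G \<Longrightarrow> F (x \<otimes> y) = F x + F y"
  shows "poly_lt G 2 F"
proof -
  have "poly_lt G 1 (\<lambda>y. F (x \<otimes> y) - F y)" if "x \<in> carrier G" for x
    using that poly_lt_cong[of "\<lambda>y. F (x \<otimes> y) - F y" "\<lambda>y. F x" 1] poly_lt_const[of 1 "F x"]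
    by (simp add: assms)
  then show ?thesis
    by (simp add: numeral_2_eq_2)
qed

text \<open>The difference of the diagonal in direction x is the constant \<open>B x x\<close> plus
  the additive map \<open>B x y + B y x\<close> in y. Since \<open>B\<close> need not be symmetric,
  both cross terms appear.\<close>

lemma poly_lt_biadditive:
  assumes "\<And>x y z. x \<in> carrier G \<Longrightarrow> y \<in> carrier G \<Longrightarrow> z \<in> carrier G \<Longrightarrow>
             B (x \<otimes> y) z = B x z + B y z"
    and "\<And>x y z. x \<in> carrier G \<Longrightarrow> y \<in> carrier G \<Longrightarrow> z \<in> carrier G \<Longrightarrow>
             B x (y \<otimes> z) = B x y + B x z"
  shows "poly_lt G 3 (\<lambda>x. B x x)"
proof -
  have "poly_lt G 2 (\<lambda>y. B (x \<otimes> y) (x \<otimes> y) - B y y)" if x: "x \<in> carrier G" for x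
  proof -
    have "poly_lt G 2 (\<lambda>y. B x x + (B x y + B y x))"
    proof (intro poly_lt_add)
      show "poly_lt G 2 (\<lambda>y. B x x)"
        by (simp add: poly_lt_const)
    qed (use x in \<open>auto intro!: poly_lt_additive simp: assms\<close>)
    moreover have "B (x \<otimes> y) (x \<otimes> y) - B y y = B x x + (B x y + B y x)" if "y \<in> carrier G" for y
      using x that by (simp add: assms algebra_simps)
    ultimately show ?thesis
      by (rule poly_lt_congI)
  qed
  then have "poly_lt G (Suc 2) (\<lambda>x. B x x)"
    by (rule poly_lt_SucI)
  then show ?thesis
    by simp
qed

end

lemma poly_lt_pullback:
  assumes "monoid H" "p \<in> hom H G" "poly_lt G m F"
  shows "poly_lt H m (\<lambda>x. F (p x))"
  using assms(3)
proof (induction m arbitrary: F)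
  case 0
  then show ?case
    using assms(2) by (auto simp: hom_def)
next
  case (Suc m)
  show ?case
  proof (rule poly_lt_SucI)
    fix x assume x: "x \<in> carrier H"
    then have "poly_lt G m (\<lambda>y. F (p x \<otimes>\<^bsub>G\<^esub> y) - F y)"
      using Suc.prems hom_in_carrier[OF assms(2)] by simp
    then have "poly_lt H m (\<lambda>y. F (p x \<otimes>\<^bsub>G\<^esub> p y) - F (p y))"
      by (rule Suc.IH)
    then show "poly_lt H m (\<lambda>y. F (p (x \<otimes>\<^bsub>H\<^esub> y)) - F (p y))"
      using x by (elim monoid.poly_lt_congI[OF assms(1)]) (simp add: hom_mult[OF assms(2)])
  qed
qed

text \<open>A function whose polynomiality is visible only after adding auxiliary data (here the
  exponent vectors) is treated upstairs and pushed down. Surjectivity lifts each direction of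
  differencing to \<open>H\<close>.\<close>

lemma poly_lt_descend:
  assumes "monoid H" "p \<in> hom H G" "carrier G \<subseteq> p ` carrier H" "poly_lt H m (\<lambda>x. F (p x))"
  shows "poly_lt G m F"
  using assms(4)
proof (induction m arbitrary: F)
  case 0
  then show ?case
    using assms(3) by auto
next
  case (Suc m)
  show ?case
  proof (rule poly_lt_SucI)
    fix y assume "y \<in> carrier G"
    then obtain x where x: "x \<in> carrier H" "y = p x"
      using assms(3) by blast
    have "poly_lt H m (\<lambda>z. F (p (x \<otimes>\<^bsub>H\<^esub> z)) - F (p z))"
      using Suc.prems x by simp
    then have "poly_lt H m (\<lambda>z. F (y \<otimes>\<^bsub>G\<^esub> p z) - F (p z))"
      using x by (elim monoid.poly_lt_congI[OF assms(1)]) (simp add: hom_mult[OF assms(2)])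
    then show "poly_lt G m (\<lambda>z. F (y \<otimes>\<^bsub>G\<^esub> z) - F z)"
      by (rule Suc.IH)
  qed
qed

section \<open>Linear functionals on the group ring\<close>

definition circle_extend :: "('a \<Rightarrow> circle) \<Rightarrow> ('a \<Rightarrow>\<^sub>0 int) \<Rightarrow> circle" where
  "circle_extend F f = (\<Sum>x\<in>Poly_Mapping.keys f. Poly_Mapping.lookup f x \<odot>\<^sub>z F x)"

lemma circle_extend_superset:
  assumes "finite S" "Poly_Mapping.keys f \<subseteq> S"
  shows "circle_extend F f = (\<Sum>x\<in>S. Poly_Mapping.lookup f x \<odot>\<^sub>z F x)"
  unfolding circle_extend_def using assms
  by (intro sum.mono_neutral_left) (auto simp: in_keys_iff)

lemma circle_extend_of [simp]: "circle_extend F (frag_of x) = F x"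
  and circle_extend_0 [simp]: "circle_extend F 0 = 0"
  by (simp_all add: circle_extend_def)

lemma circle_extend_diff: "circle_extend F (f - g) = circle_extend F f - circle_extend F g"
proof -
  let ?S = "Poly_Mapping.keys f \<union> Poly_Mapping.keys g"
  have "Poly_Mapping.keys (f - g) \<subseteq> ?S"
    by (rule keys_diff)
  then show ?thesis
    by (simp add: circle_extend_superset[of ?S] lookup_minus zmul_diff_left sum_subtractf)
qed

section \<open>Powers of the augmentation ideal and dimension subgroups\<close>

context group
begin

lemma minus_one_in_carrier:
  assumes "x \<in> carrier G"
  shows "minus_one G x \<in> carrier (group_ring G)"
  using assms keys_diff[of "frag_of x" "frag_of \<one>"]
  by (auto simp: minus_one_def keys_frag_of)

lemma minus_one_in_augmentation_ideal:
  "x \<in> carrier G \<Longrightarrow> minus_one G x \<in> augmentation_ideal G"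
  using minus_one_in_carrier
  by (simp add: augmentation_ideal_def augmentation_diff minus_one_def)

lemma augmentation_power_is_ideal: "ideal (augmentation_power G m) (group_ring G)"
proof (induction m)
  case 0
  then show ?case
    using ring.oneideal[OF group_ring_is_ring] by simp
next
  case (Suc m)
  then show ?case
    using ring.ideal_prod_is_ideal[OF group_ring_is_ring augmentation_ideal_is_ideal] by simp
qed

lemma augmentation_power_in_carrier:
  "f \<in> augmentation_power G m \<Longrightarrow> f \<in> carrier (group_ring G)"
  using ideal.Icarr[OF augmentation_power_is_ideal] .

lemma group_ring_uminus:
  assumes "f \<in> carrier (group_ring G)"
  shows "\<ominus>\<^bsub>group_ring G\<^esub> f = - f"
proof -
  interpret R: ring "group_ring G"
    by (rule group_ring_is_ring)
  show ?thesis
    using assms by (intro R.minus_equality) auto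
qed

lemma augmentation_power_diff:
  assumes "f \<in> augmentation_power G m" "g \<in> augmentation_power G m"
  shows "f - g \<in> augmentation_power G m"
proof -
  interpret ideal "augmentation_power G m" "group_ring G"
    by (rule augmentation_power_is_ideal)
  have "- g \<in> augmentation_power G m"
    using additive_subgroup.a_inv_closed[OF is_additive_subgroup assms(2)] assms(2) group_ring_uminus augmentation_power_in_carrier
    by metis
  then show ?thesis
    using additive_subgroup.a_closed[OF is_additive_subgroup assms(1)] by fastforce
qed

lemma augmentation_power_0: "0 \<in> augmentation_power G m"
  using additive_subgroup.zero_closed[OF ideal.axioms(1)[OF augmentation_power_is_ideal[of m]]]
  by simp

lemma minus_one_mult_augmentation_power:
  assumes "x \<in> carrier G" "f \<in> augmentation_power G m"
  shows "minus_one G x \<otimes>\<^bsub>group_ring G\<^esub> f \<in> augmentation_power G (Suc m)"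
  unfolding augmentation_power.simps
  by (intro ideal_prod.prod minus_one_in_augmentation_ideal assms)

lemma minus_one_mult:
  assumes "x \<in> carrier G" "f \<in> carrier (group_ring G)"
  shows "minus_one G x \<otimes>\<^bsub>group_ring G\<^esub> f = frag_extend (\<lambda>y. frag_of (x \<otimes> y)) f - f"
proof -
  interpret R: ring "group_ring G"
    by (rule group_ring_is_ring)
  show ?thesis
    using R.l_one[OF assms(2)] by (simp add: minus_one_def frag_extend_diff)
qed

text \<open>Each power of the augmentation ideal is generated additively by the elements (x - 1) f
  with f in the previous power, and the group ring by the group elements. Closure under differences,
  together with 0, covers all additive combinations.\<close>

lemma augmentation_power_induct [consumes 1, case_names zero diff of mult]:
  assumes "f \<in> augmentation_power G m"
    and zero: "\<And>m. J m 0"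
    and diff: "\<And>m f g. f \<in> augmentation_power G m \<Longrightarrow> g \<in> augmentation_power G m \<Longrightarrow>
                 J m f \<Longrightarrow> J m g \<Longrightarrow> J m (f - g)"
    and of: "\<And>x. x \<in> carrier G \<Longrightarrow> J 0 (frag_of x)"
    and mult: "\<And>m x f. x \<in> carrier G \<Longrightarrow> f \<in> augmentation_power G m \<Longrightarrow> J m f \<Longrightarrow>
                 J (Suc m) (minus_one G x \<otimes>\<^bsub>group_ring G\<^esub> f)"
  shows "J m f"
  using assms(1)
proof (induction m arbitrary: f)
  case 0
  then have "Poly_Mapping.keys f \<subseteq> carrier G"
    by simp
  then have "Poly_Mapping.keys f \<subseteq> carrier G \<and> J 0 f"
  proof (induction f rule: frag_induction)
    case (diff a b)
    then show ?case
      using assms(3)[of a 0 b] keys_diff[of a b] by auto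
  qed (auto simp: zero of keys_frag_of)
  then show ?case ..
next
  case (Suc m)
  from Suc.prems have "f \<in> ideal_prod (group_ring G) (augmentation_ideal G) (augmentation_power G m)"
    by simp
  then have "f \<in> augmentation_power G (Suc m) \<and> J (Suc m) f"
  proof (induction f)
    case (prod i j)
    have *: "minus_one G x \<otimes>\<^bsub>group_ring G\<^esub> j \<in> augmentation_power G (Suc m) \<and>
             J (Suc m) (minus_one G x \<otimes>\<^bsub>group_ring G\<^esub> j)" if "x \<in> carrier G" for x
      using minus_one_mult_augmentation_power mult that Suc.IH prod.hyps(2) by blast
    \<comment> \<open>Subtracting the augmentation turns a basis element x into x - 1, so
      \<open>i\<close> can be decomposed into group elements without leaving the ideal. On the
      actual \<open>i\<close>, of augmentation 0, the correction vanishes.\<close>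
    let ?e = "\<lambda>i. (i - frag_cmul (augmentation i) (frag_of \<one>)) \<otimes>\<^bsub>group_ring G\<^esub> j"
    have "Poly_Mapping.keys i \<subseteq> carrier G"
      using prod.hyps(1) by (simp add: augmentation_ideal_def)
    then have "?e i \<in> augmentation_power G (Suc m) \<and> J (Suc m) (?e i)"
    proof (induction i rule: frag_induction)
      case zero
      show ?case
        using augmentation_power_0[of "Suc m"] assms(2) by simp
    next
      case (one x)
      then show ?case
        using *[of x] by (simp add: minus_one_def)
    next
      case (diff a b)
      have "?e (a - b) = ?e a - ?e b"
        by (simp add: augmentation_diff frag_cmul_diff_distrib frag_extend_diff)
      then show ?case
        using diff assms(3) augmentation_power_diff by metis
    qed
    moreover have "?e i = i \<otimes>\<^bsub>group_ring G\<^esub> j"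
      using prod.hyps(1) by (simp add: augmentation_ideal_def)
    ultimately show ?case
      by simp
  next
    case (sum f g)
    have "J (Suc m) (f - (0 - g))" "f - (0 - g) \<in> augmentation_power G (Suc m)"
      using sum.IH assms(3)[of _ "Suc m"] zero[of "Suc m"] augmentation_power_0[of "Suc m"]
        augmentation_power_diff[of _ "Suc m"] by meson+
    then show ?case
      by simp
  qed
  then show ?case ..
qed

text \<open>Under the pairing of functions with ring elements, left multiplication by x - 1 is dual
  to the difference in direction x. Thus \<open>m\<close> such factors use up the \<open>m\<close>
  differences that \<open>F\<close> can take before it vanishes.\<close>

lemma augmentation_power_circle_extend:
  assumes "f \<in> augmentation_power G m" "poly_lt G m F"
  shows "circle_extend F f = 0"
  using assms
proof (induction arbitrary: F rule: augmentation_power_induct)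
  case (mult m x f)
  have *: "circle_extend F (frag_extend (\<lambda>y. frag_of (x \<otimes> y)) f) - circle_extend F f =
           circle_extend (\<lambda>y. F (x \<otimes> y) - F y) f"
    using subset_UNIV[of "Poly_Mapping.keys f"]
    by (induction f rule: frag_induction)
       (auto simp: frag_extend_diff circle_extend_diff algebra_simps)
  have "circle_extend (\<lambda>y. F (x \<otimes> y) - F y) f = 0"
    using mult by simp
  then show ?case
    using mult.hyps minus_one_mult[OF mult.hyps(1) augmentation_power_in_carrier]
    by (simp add: circle_extend_diff * del: group_ring_simps)
qed (simp_all add: circle_extend_diff)

lemma poly_lt_dimension_subgroup:
  assumes "x \<in> dimension_subgroup m G" "poly_lt G m F"
  shows "F x = F \<one>"
  using augmentation_power_circle_extend[of "minus_one G x" m F] assms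
  by (simp add: dimension_subgroup_def minus_one_def circle_extend_diff)

text \<open>Membership is certified by an expression in finitely many group elements, and the same
  expression is valid in every subgroup containing them. This later reduces the infinite product to
  a finite set of tuples.\<close>

lemma augmentation_power_finite_support:
  assumes "f \<in> augmentation_power G m"
  shows "\<exists>W. finite W \<and> W \<subseteq> carrier G \<and>
           (\<forall>S. subgroup S G \<longrightarrow> W \<subseteq> S \<longrightarrow> f \<in> augmentation_power (G\<lparr>carrier := S\<rparr>) m)"
  using assms
proof (induction rule: augmentation_power_induct)
  case (zero m)
  then show ?case
    by (intro exI[of _ "{}"])
      (auto intro!: group.augmentation_power_0 subgroup.subgroup_is_group[OF _ group_axioms])
next
  case (diff m f g)
  then obtain W W' where W: "finite W" "W \<subseteq> carrier G"
      "\<And>S. subgroup S G \<Longrightarrow> W \<subseteq> S \<Longrightarrow> f \<in> augmentation_power (G\<lparr>carrier := S\<rparr>) m"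
    and W': "finite W'" "W' \<subseteq> carrier G"
      "\<And>S. subgroup S G \<Longrightarrow> W' \<subseteq> S \<Longrightarrow> g \<in> augmentation_power (G\<lparr>carrier := S\<rparr>) m"
    by metis
  then show ?case
    by (intro exI[of _ "W \<union> W'"])
      (auto intro!: group.augmentation_power_diff subgroup.subgroup_is_group[OF _ group_axioms])
next
  case (of x)
  then show ?case
    by (intro exI[of _ "{x}"]) (auto simp: keys_frag_of)
next
  case (mult m x f)
  then obtain W where W: "finite W" "W \<subseteq> carrier G"
      "\<And>S. subgroup S G \<Longrightarrow> W \<subseteq> S \<Longrightarrow> f \<in> augmentation_power (G\<lparr>carrier := S\<rparr>) m"
    by metis
  have "minus_one G x \<otimes>\<^bsub>group_ring G\<^esub> f \<in> augmentation_power (G\<lparr>carrier := S\<rparr>) (Suc m)"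
    if "subgroup S G" "W \<subseteq> S" "x \<in> S" for S
  proof -
    interpret S: group "G\<lparr>carrier := S\<rparr>"
      using that(1) by (rule subgroup.subgroup_is_group[OF _ group_axioms])
    show ?thesis
      using S.minus_one_mult_augmentation_power[of x f m] that W(3)[OF that(1,2)]
      by (simp add: minus_one_def)
  qed
  then show ?case
    using W mult.hyps(1) by (intro exI[of _ "insert x W"]) auto
qed

lemma dimension_subgroup_finite_support:
  assumes "x \<in> dimension_subgroup m G"
  shows "\<exists>W. finite W \<and> W \<subseteq> carrier G \<and>
           (\<forall>S. subgroup S G \<longrightarrow> W \<subseteq> S \<longrightarrow> x \<in> S \<longrightarrow>
             x \<in> dimension_subgroup m (G\<lparr>carrier := S\<rparr>))"
proof -
  have "minus_one (G\<lparr>carrier := S\<rparr>) x = minus_one G x" for S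
    by (simp add: minus_one_def)
  then show ?thesis
    using augmentation_power_finite_support[of "minus_one G x" m] assms
    by (auto simp: dimension_subgroup_def)
qed

text \<open>Uses x y - 1 = x (y - 1) + (x - 1) and the left ideal property.\<close>

lemma dimension_subgroup_mult:
  assumes "x \<in> dimension_subgroup m G" "y \<in> dimension_subgroup m G"
  shows "x \<otimes> y \<in> dimension_subgroup m G"
proof -
  interpret ideal "augmentation_power G m" "group_ring G"
    by (rule augmentation_power_is_ideal)
  have xy: "x \<in> carrier G" "y \<in> carrier G"
    "minus_one G x \<in> augmentation_power G m" "minus_one G y \<in> augmentation_power G m"
    using assms by (auto simp: dimension_subgroup_def)
  have "frag_of x \<otimes>\<^bsub>group_ring G\<^esub> minus_one G y \<in> augmentation_power G m"
    using xy by (intro I_l_closed) (auto simp: keys_frag_of)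
  from additive_subgroup.a_closed[OF is_additive_subgroup this xy(3)] have "minus_one G (x \<otimes> y) \<in> augmentation_power G m"
    using xy(1,2) by (simp add: minus_one_def frag_extend_diff)
  then show ?thesis
    using xy by (simp add: dimension_subgroup_def)
qed

lemma dimension_subgroup_one: "\<one> \<in> dimension_subgroup m G"
  by (simp add: dimension_subgroup_def minus_one_def augmentation_power_0)

lemma dimension_subgroup_hom:
  assumes "group H" "p \<in> hom G H" "x \<in> dimension_subgroup m G"
  shows "p x \<in> dimension_subgroup m H"
proof -
  interpret H: group H
    by fact
  interpret group_hom G H p
    by unfold_locales (rule assms(2))
  let ?p = "frag_extend (\<lambda>x. frag_of (p x))"
  have "?p f \<in> augmentation_power H m" if "f \<in> augmentation_power G m" for f
    using that
  proof (induction rule: augmentation_power_induct)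
    case (mult m x f)
    have "Poly_Mapping.keys f \<subseteq> carrier G"
      using augmentation_power_in_carrier mult.hyps(2) by auto
    then have "?p (frag_extend (\<lambda>y. frag_of (x \<otimes> y)) f) =
               frag_extend (\<lambda>y. frag_of (p x \<otimes>\<^bsub>H\<^esub> y)) (?p f)"
      using mult.hyps(1)
      by (induction f rule: frag_induction) (auto simp: frag_extend_diff)
    then have "?p (minus_one G x \<otimes>\<^bsub>group_ring G\<^esub> f) = minus_one H (p x) \<otimes>\<^bsub>group_ring H\<^esub> ?p f"
      using mult.hyps(1,2) mult.IH augmentation_power_in_carrier H.augmentation_power_in_carrier
      by (simp add: minus_one_mult H.minus_one_mult frag_extend_diff del: group_ring_simps)
    then show ?case
      using H.minus_one_mult_augmentation_power[OF _ mult.IH] mult.hyps(1) by simp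
  qed (auto simp: frag_extend_diff H.augmentation_power_0 H.augmentation_power_diff keys_frag_of)
  from this[of "minus_one G x"] show ?thesis
    using assms(3) by (simp add: dimension_subgroup_def minus_one_def frag_extend_diff)
qed

end


section \<open>Words in a tuple of group elements\<close>

text \<open>The additive group of exponent vectors, written multiplicatively so that
  \<open>hom\<close> and \<open>poly_lt\<close> apply. Vectors are total functions; a word reads
  only the coordinates in its index list.\<close>

definition int_vectors :: "(nat \<Rightarrow> int) monoid" where
  "int_vectors = \<lparr>carrier = UNIV, monoid.mult = (\<lambda>m n i. m i + n i), monoid.one = (\<lambda>i. 0)\<rparr>"

lemma int_vectors_simps [simp]:
  "carrier int_vectors = UNIV" "m \<otimes>\<^bsub>int_vectors\<^esub> n = (\<lambda>i. m i + n i)"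
  "\<one>\<^bsub>int_vectors\<^esub> = (\<lambda>i. 0)"
  by (simp_all add: int_vectors_def)

lemma comm_group_int_vectors: "comm_group int_vectors"
proof (rule comm_groupI)
  fix m assume "m \<in> carrier int_vectors"
  show "\<exists>n\<in>carrier int_vectors. n \<otimes>\<^bsub>int_vectors\<^esub> m = \<one>\<^bsub>int_vectors\<^esub>"
    by (intro bexI[of _ "\<lambda>i. - m i"]) auto
qed (simp_all add: add_ac)

interpretation int_vectors: comm_group int_vectors
  by (rule comm_group_int_vectors)

text \<open>The indices form a list because the order of the noncommuting factors matters.\<close>

primrec word :: "('a, 'b) monoid_scheme \<Rightarrow> (nat \<Rightarrow> 'a) \<Rightarrow> nat list \<Rightarrow> (nat \<Rightarrow> int) \<Rightarrow> 'a" where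
  "word G x [] n = \<one>\<^bsub>G\<^esub>"
| "word G x (i # js) n = x i [^]\<^bsub>G\<^esub> n i \<otimes>\<^bsub>G\<^esub> word G x js n"

lemma word_cong:
  "(\<And>i. i \<in> set js \<Longrightarrow> m i = n i) \<Longrightarrow> word G x js m = word G x js n"
  by (induction js) auto

lemma (in group) word_closed [simp]: "x ` set js \<subseteq> carrier G \<Longrightarrow> word G x js n \<in> carrier G"
  by (induction js) auto

lemma (in group) word_append:
  "x ` set (js @ ks) \<subseteq> carrier G \<Longrightarrow> word G x (js @ ks) n = word G x js n \<otimes> word G x ks n"
  by (induction js) (auto simp: m_assoc image_Un)

lemma (in group) word_zero: "(\<And>i. i \<in> set js \<Longrightarrow> n i = 0) \<Longrightarrow> word G x js n = \<one>"
  by (induction js) auto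

lemma (in group_hom) hom_word:
  "x ` set js \<subseteq> carrier G \<Longrightarrow> h (word G x js n) = word H (\<lambda>i. h (x i)) js n"
  by (induction js) (auto simp: hom_int_pow)

lemma (in comm_group) word_add:
  assumes "x ` set js \<subseteq> carrier G"
  shows "word G x js (\<lambda>i. m i + n i) = word G x js m \<otimes> word G x js n"
  using assms by (induction js) (auto simp: int_pow_mult m_ac)

lemma (in group) additive_one:
  fixes t :: "'a \<Rightarrow> circle"
  assumes "\<And>g h. g \<in> carrier G \<Longrightarrow> h \<in> carrier G \<Longrightarrow> t (g \<otimes> h) = t g + t h"
  shows "t \<one> = 0"
  using assms[of \<one> \<one>] by simp

lemma (in group) additive_int_pow:
  fixes t :: "'a \<Rightarrow> circle"
  assumes t: "\<And>g h. g \<in> carrier G \<Longrightarrow> h \<in> carrier G \<Longrightarrow> t (g \<otimes> h) = t g + t h"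
    and g: "g \<in> carrier G"
  shows "t (g [^] (n :: int)) = n \<odot>\<^sub>z t g"
proof (induction n rule: int_induct[where k = 0])
  case base
  then show ?case
    using additive_one[OF t] by simp
next
  case (step1 n)
  then show ?case
    using g by (simp add: int_pow_mult t zmul_add_left)
next
  case (step2 n)
  have "t (g [^] n) = t (g [^] (n - 1)) + t g"
    using g int_pow_mult[OF g, of "n - 1" 1] t[of "g [^] (n - 1)" g] by simp
  then show ?case
    using step2 by (simp add: zmul_diff_left algebra_simps)
qed

lemma (in group) additive_word_add:
  fixes t :: "'a \<Rightarrow> circle"
  assumes t: "\<And>g h. g \<in> carrier G \<Longrightarrow> h \<in> carrier G \<Longrightarrow> t (g \<otimes> h) = t g + t h"
    and "x ` set js \<subseteq> carrier G"
  shows "t (word G x js (\<lambda>i. m i + n i)) = t (word G x js m) + t (word G x js n)"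
  using assms(2) additive_one[OF t] by (induction js) (auto simp: int_pow_mult t add_ac)

lemma (in group) additive_word:
  fixes t :: "'a \<Rightarrow> circle"
  assumes t: "\<And>g h. g \<in> carrier G \<Longrightarrow> h \<in> carrier G \<Longrightarrow> t (g \<otimes> h) = t g + t h"
    and "x ` set js \<subseteq> carrier G" "distinct js"
  shows "t (word G x js n) = (\<Sum>j\<in>set js. n j \<odot>\<^sub>z t (x j))"
  using assms(2,3) additive_one[OF t] by (induction js) (auto simp: additive_int_pow[OF t] t)


section \<open>Groups of class three\<close>

lemma (in normal) r_coset_eq_iff:
  assumes "x \<in> carrier G" "y \<in> carrier G"
  shows "H #> x = H #> y \<longleftrightarrow> inv x \<otimes> y \<in> H"
proof -
  have "H #> x = H #> y \<longleftrightarrow> y \<in> H #> x"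
    using assms repr_independence repr_independenceD subgroup_axioms by metis
  also have "\<dots> \<longleftrightarrow> y \<otimes> inv x \<in> H"
    using assms by (simp add: rcos_module is_group)
  also have "\<dots> \<longleftrightarrow> inv x \<otimes> y \<in> H"
    using inv_op_closed1[of x "y \<otimes> inv x"] inv_op_closed2[of x "inv x \<otimes> y"] assms
    by (auto simp: m_assoc inv_mult_cancel)
  finally show ?thesis .
qed

context group
begin

lemma lower_central_2_normal: "lower_central G 2 \<lhd> G"
  by (simp add: lower_central_2 derived_self_is_normal)

lemma ab_class_hom: "ab_class G \<in> hom G (abelianization G)"
proof -
  interpret normal "derived G (carrier G)" G
    by (rule derived_self_is_normal)
  show ?thesis
    using r_coset_hom_Mod by (simp add: abelianization_def ab_class_def[abs_def])
qed

lemma comm_group_abelianization: "comm_group (abelianization G)"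
  unfolding abelianization_def by (rule derived_quot_is_comm_group)

lemma ab_class_eq_iff:
  assumes "g \<in> carrier G" "h \<in> carrier G"
  shows "ab_class G g = ab_class G h \<longleftrightarrow> inv g \<otimes> h \<in> lower_central G 2"
  using normal.r_coset_eq_iff[OF derived_self_is_normal assms]
  by (simp add: ab_class_def lower_central_2)

lemma group_hom_ab_class: "group_hom G (abelianization G) (ab_class G)"
  using ab_class_hom comm_group_abelianization
  by (simp add: group_hom_def group_hom_axioms_def comm_group_def)

text \<open>Words are not multiplicative in the exponent vector in \<open>G\<close>, but they become
  so in the commutative quotient.\<close>

lemma ab_class_word_add:
  assumes "x ` set js \<subseteq> carrier G"
  shows "ab_class G (word G x js (\<lambda>i. m i + n i)) = ab_class G (word G x js m \<otimes> word G x js n)"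
proof -
  interpret A: comm_group "abelianization G"
    by (rule comm_group_abelianization)
  interpret h: group_hom G "abelianization G" "ab_class G"
    by (rule group_hom_ab_class)
  have "(\<lambda>i. ab_class G (x i)) ` set js \<subseteq> carrier (abelianization G)"
    using assms by auto
  then show ?thesis
    using assms by (simp add: h.hom_word A.word_add)
qed

lemma gamma2_eq:
  "lower_central G 2 = generate G {commutator G x y | x y. x \<in> carrier G \<and> y \<in> carrier G}"
  by (simp add: numeral_2_eq_2)

lemma commutator_in_gamma2:
  "x \<in> carrier G \<Longrightarrow> y \<in> carrier G \<Longrightarrow> commutator G x y \<in> lower_central G 2"
  by (auto simp: numeral_2_eq_2 intro!: generate.incl)

lemma commutator_in_gamma3:
  "x \<in> lower_central G 2 \<Longrightarrow> y \<in> carrier G \<Longrightarrow> commutator G x y \<in> lower_central G 3"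
  by (auto simp: numeral_3_eq_3 numeral_2_eq_2 intro!: generate.incl)

lemma gamma2_closed: "c \<in> lower_central G 2 \<Longrightarrow> c \<in> carrier G"
  using normal_imp_subgroup[OF lower_central_2_normal] subgroup.mem_carrier by metis

lemma gamma3_eq:
  "lower_central G 3 =
     generate G {commutator G x y | x y. x \<in> lower_central G 2 \<and> y \<in> carrier G}"
  by (simp add: numeral_3_eq_3 numeral_2_eq_2)

lemma gamma3_subset_gamma2: "lower_central G 3 \<subseteq> lower_central G 2"
  unfolding gamma3_eq
  by (rule generate_subgroup_incl)
    (auto intro: commutator_in_gamma2 gamma2_closed normal_imp_subgroup lower_central_2_normal)

lemma gamma3_subgroup: "subgroup (lower_central G 3) G"
  unfolding gamma3_eq
  by (rule generate_is_subgroup) (auto simp: commutator_def gamma2_closed)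

lemma gamma3_closed: "c \<in> lower_central G 3 \<Longrightarrow> c \<in> carrier G"
  using gamma3_subset_gamma2 gamma2_closed by blast

end

locale class_three_group = group G for G :: "('a, 'b) monoid_scheme" (structure) +
  assumes gamma4: "lower_central G 4 = {\<one>}"
begin

sublocale gamma2: normal "lower_central G 2" G
  by (rule lower_central_2_normal)

lemma gamma3_central:
  assumes "w \<in> lower_central G 3" "g \<in> carrier G"
  shows "w \<otimes> g = g \<otimes> w"
proof -
  have "commutator G w g \<in> lower_central G (Suc (Suc 2))"
    unfolding lower_central.simps(3)
    by (rule generate.incl) (use assms in auto)
  then have *: "w \<otimes> g \<otimes> inv w \<otimes> inv g = \<one>"
    by (simp add: gamma4 commutator_def)
  have "w \<otimes> g = w \<otimes> g \<otimes> inv w \<otimes> inv g \<otimes> (g \<otimes> w)"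
    using assms gamma3_closed by (simp add: m_assoc inv_mult_cancel)
  then show ?thesis
    using assms gamma3_closed by (simp add: *)
qed

lemma conj_gamma2:
  assumes "c \<in> lower_central G 2" "g \<in> carrier G"
  obtains w where "w \<in> lower_central G 3" "inv g \<otimes> c \<otimes> g = c \<otimes> w"
proof
  show "commutator G (inv c) (inv g) \<in> lower_central G 3"
    using assms by (intro commutator_in_gamma3) auto
  show "inv g \<otimes> c \<otimes> g = c \<otimes> commutator G (inv c) (inv g)"
    using assms by (simp add: commutator_def m_assoc inv_mult_cancel)
qed

text \<open>Moving c past an element multiplies c by a central factor, and these factors multiply
  along products. Hence a b and b a change c by the same factor, so the commutator of a and b lies
  in the centralizer \<open>?C\<close> of c, which therefore contains all of
  \<open>\<gamma>\<^sub>2\<close>.\<close>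

lemma gamma2_commute:
  assumes c: "c \<in> lower_central G 2" and c': "c' \<in> lower_central G 2"
  shows "c \<otimes> c' = c' \<otimes> c"
proof -
  have cc: "c \<in> carrier G"
    using c by simp
  let ?C = "{g \<in> carrier G. c \<otimes> g = g \<otimes> c}"
  have C: "subgroup ?C G"
  proof (rule subgroupI)
    fix g assume "g \<in> ?C"
    then have g: "g \<in> carrier G" "c \<otimes> g = g \<otimes> c"
      by auto
    have "c \<otimes> inv g = inv g \<otimes> (g \<otimes> c) \<otimes> inv g"
      using g(1) cc by (simp add: m_assoc inv_mult_cancel)
    also have "\<dots> = inv g \<otimes> c"
      unfolding g(2)[symmetric] using g(1) cc by (simp add: m_assoc)
    finally show "inv g \<in> ?C"
      using g(1) by simp
  next
    fix g h assume "g \<in> ?C" "h \<in> ?C"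
    then have gh: "g \<in> carrier G" "h \<in> carrier G" "c \<otimes> g = g \<otimes> c" "c \<otimes> h = h \<otimes> c"
      by auto
    have "c \<otimes> (g \<otimes> h) = g \<otimes> (c \<otimes> h)"
      using gh(1-3) cc by (metis m_assoc)
    then show "g \<otimes> h \<in> ?C"
      using gh cc by (simp add: m_assoc)
  qed (use cc in \<open>auto intro: exI[of _ \<one>]\<close>)
  have comm: "commutator G a b \<in> ?C" if a: "a \<in> carrier G" and b: "b \<in> carrier G" for a b
  proof -
    obtain u where u: "u \<in> lower_central G 3" "inv a \<otimes> c \<otimes> a = c \<otimes> u"
      using conj_gamma2 c a by blast
    obtain v where v: "v \<in> lower_central G 3" "inv b \<otimes> c \<otimes> b = c \<otimes> v"
      using conj_gamma2 c b by blast
    have uv: "u \<in> carrier G" "v \<in> carrier G"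
      using u(1) v(1) gamma3_closed by blast+
    have ca: "c \<otimes> a = a \<otimes> (c \<otimes> u)" and cb: "c \<otimes> b = b \<otimes> (c \<otimes> v)"
      using a b cc by (simp_all flip: u(2) v(2) add: m_assoc inv_mult_cancel)
    have "c \<otimes> (a \<otimes> b) = a \<otimes> (c \<otimes> (u \<otimes> b))"
      using a b cc uv ca by (simp flip: m_assoc)
    also have "\<dots> = a \<otimes> b \<otimes> (c \<otimes> (v \<otimes> u))"
      using a b cc uv cb gamma3_central[OF u(1) b] by (simp add: m_assoc) (simp flip: m_assoc)
    finally have ab: "c \<otimes> (a \<otimes> b) = a \<otimes> b \<otimes> (c \<otimes> (v \<otimes> u))" .
    have "c \<otimes> (b \<otimes> a) = b \<otimes> (c \<otimes> (v \<otimes> a))"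
      using a b cc uv cb by (simp flip: m_assoc)
    also have "\<dots> = b \<otimes> a \<otimes> (c \<otimes> (u \<otimes> v))"
      using a b cc uv ca gamma3_central[OF v(1) a] by (simp add: m_assoc) (simp flip: m_assoc)
    also have "u \<otimes> v = v \<otimes> u"
      using gamma3_central[OF u(1)] uv by blast
    finally have ba: "c \<otimes> (b \<otimes> a) = b \<otimes> a \<otimes> (c \<otimes> (v \<otimes> u))" .
    have "c \<otimes> commutator G a b = c \<otimes> (a \<otimes> b) \<otimes> inv (b \<otimes> a)"
      using a b cc by (simp add: commutator_def m_assoc inv_mult_group)
    also have "\<dots> = a \<otimes> b \<otimes> inv (b \<otimes> a) \<otimes> (b \<otimes> a \<otimes> (c \<otimes> (v \<otimes> u))) \<otimes> inv (b \<otimes> a)"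
      unfolding ab using a b cc uv by (simp add: m_assoc inv_mult_group inv_mult_cancel)
    also have "\<dots> = a \<otimes> b \<otimes> inv (b \<otimes> a) \<otimes> (c \<otimes> (b \<otimes> a)) \<otimes> inv (b \<otimes> a)"
      unfolding ba ..
    also have "\<dots> = commutator G a b \<otimes> c"
      using a b cc by (simp add: commutator_def m_assoc inv_mult_group inv_mult_cancel)
    finally show ?thesis
      using a b by (simp add: commutator_def)
  qed
  have "generate G {commutator G x y | x y. x \<in> carrier G \<and> y \<in> carrier G} \<subseteq> ?C"
  proof (rule generate_subgroup_incl[OF _ C], rule subsetI)
    fix g assume "g \<in> {commutator G x y | x y. x \<in> carrier G \<and> y \<in> carrier G}"
    then obtain a b where "g = commutator G a b" "a \<in> carrier G" "b \<in> carrier G"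
      by auto
    then show "g \<in> ?C"
      using comm[of a b] by simp
  qed
  moreover have "c' \<in> generate G {commutator G x y | x y. x \<in> carrier G \<and> y \<in> carrier G}"
    using c' unfolding gamma2_eq .
  ultimately show ?thesis
    by blast
qed

end

section \<open>Multiplicativity of triple commutators in class three\<close>

context class_three_group
begin

lemma commutator_mult_gamma2:
  assumes "c \<in> lower_central G 2" "c' \<in> lower_central G 2" "g \<in> carrier G"
  shows "commutator G (c \<otimes> c') g = commutator G c g \<otimes> commutator G c' g"
proof -
  have c3: "commutator G c' g \<in> lower_central G 3"
    by (rule commutator_in_gamma3[OF assms(2,3)])
  have "commutator G (c \<otimes> c') g = c \<otimes> (commutator G c' g \<otimes> (g \<otimes> inv c \<otimes> inv g))"
    using assms by (simp add: commutator_def m_assoc inv_mult_group inv_mult_cancel)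
  also have "commutator G c' g \<otimes> (g \<otimes> inv c \<otimes> inv g) = g \<otimes> inv c \<otimes> inv g \<otimes> commutator G c' g"
    using assms by (intro gamma3_central[OF c3]) auto
  finally show ?thesis
    using assms gamma3_closed[OF c3] by (simp add: commutator_def[of G c] m_assoc)
qed

lemma commutator_gamma3:
  assumes "w \<in> lower_central G 3" "g \<in> carrier G"
  shows "commutator G w g = \<one>"
  using gamma3_central[OF assms] gamma3_closed[OF assms(1)] assms(2)
  by (simp add: commutator_def m_assoc inv_mult_cancel)

text \<open>The inner commutator of a product is a conjugate of the one for \<open>g'\<close> times
  the one for \<open>g\<close>. Conjugation only adds a factor from \<open>\<gamma>\<^sub>3\<close>,
  which the outer commutator kills.\<close>

lemma triple_commutator_mult:
  assumes "g \<in> carrier G" "g' \<in> carrier G" "x \<in> carrier G" "y \<in> carrier G"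
  shows "commutator G (commutator G (g \<otimes> g') x) y =
         commutator G (commutator G g' x) y \<otimes> commutator G (commutator G g x) y"
proof -
  let ?c = "commutator G g' x" and ?c' = "commutator G g x"
  have c: "?c \<in> lower_central G 2" "?c' \<in> lower_central G 2"
    using assms commutator_in_gamma2 by auto
  obtain w where w: "w \<in> lower_central G 3" "inv (inv g) \<otimes> ?c \<otimes> inv g = ?c \<otimes> w"
    using conj_gamma2[OF c(1), of "inv g"] assms(1) by blast
  have w2: "w \<in> lower_central G 2"
    using w(1) gamma3_subset_gamma2 by blast
  have "commutator G (g \<otimes> g') x = inv (inv g) \<otimes> ?c \<otimes> inv g \<otimes> ?c'"
    using assms by (simp add: commutator_def m_assoc inv_mult_group inv_mult_cancel)
  also have "\<dots> = ?c \<otimes> w \<otimes> ?c'"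
    unfolding w(2) ..
  finally show ?thesis
    using c w w2 assms commutator_gamma3[OF w(1)] gamma3_closed[OF commutator_in_gamma3[OF c(1)]]
    by (simp add: commutator_mult_gamma2)
qed

text \<open>Every power of a triple commutator is thus a single triple commutator, which keeps the
  commutator length of the coordinates of \<open>h\<close> bounded.\<close>

lemma triple_commutator_pow:
  assumes "g \<in> carrier G" "x \<in> carrier G" "y \<in> carrier G"
  shows "commutator G (commutator G (g [^] (s :: nat)) x) y =
         commutator G (commutator G g x) y [^] s"
proof (induction s)
  case 0
  have "commutator G \<one> x = \<one>" "commutator G \<one> y = \<one>"
    using assms by (simp_all add: commutator_def)
  then show ?case
    by simp
next
  case (Suc s)
  have "commutator G (commutator G g x) y \<in> carrier G"
    using assms by (simp add: commutator_def)
  then show ?case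
    using assms Suc nat_pow_Suc2 by (simp add: triple_commutator_mult)
qed

end

section \<open>Characters of the second lower central term and the functions they induce on
  words\<close>

locale gamma2_character = class_three_group G for G :: "('a, 'b) monoid_scheme" (structure) +
  fixes \<chi> :: "'a \<Rightarrow> circle"
  assumes chi_mult:
    "c \<in> lower_central G 2 \<Longrightarrow> c' \<in> lower_central G 2 \<Longrightarrow> \<chi> (c \<otimes> c') = \<chi> c + \<chi> c'"
begin

lemma chi_one: "\<chi> \<one> = 0"
  using chi_mult[of \<one> \<one>] by simp

lemma chi_inv: "c \<in> lower_central G 2 \<Longrightarrow> \<chi> (inv c) = - \<chi> c"
  using chi_mult[of "inv c" c] chi_one by (simp add: eq_neg_iff_add_eq_0)

lemma chi_int_pow:
  assumes "c \<in> lower_central G 2"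
  shows "\<chi> (c [^] (n :: int)) = n \<odot>\<^sub>z \<chi> c"
proof -
  interpret S: group "G\<lparr>carrier := lower_central G 2\<rparr>"
    by (rule gamma2.subgroup_is_group[OF is_group])
  show ?thesis
    using S.additive_int_pow[of \<chi> c n] assms
    by (simp add: chi_mult int_pow_consistent[OF gamma2.subgroup_axioms])
qed

text \<open>The failure of \<open>\<chi>\<close> to be invariant under conjugation. In class three
  it is additive in both arguments, vanishes for \<open>c\<close> in
  \<open>\<gamma>\<^sub>3\<close>, and equals the value of \<open>\<chi>\<close> at the commutator
  of \<open>c\<close> and \<open>g\<close>.\<close>

definition twist :: "'a \<Rightarrow> 'a \<Rightarrow> circle" where
  "twist c g = \<chi> (inv g \<otimes> c \<otimes> g) - \<chi> c"

lemma twist_gamma3: "w \<in> lower_central G 3 \<Longrightarrow> g \<in> carrier G \<Longrightarrow> twist w g = 0"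
  using gamma3_central[of w g] gamma3_closed[of w]
  by (simp add: twist_def m_assoc inv_mult_cancel)

lemma twist_mult_left:
  assumes "c \<in> lower_central G 2" "c' \<in> lower_central G 2" "g \<in> carrier G"
  shows "twist (c \<otimes> c') g = twist c g + twist c' g"
proof -
  have "inv g \<otimes> (c \<otimes> c') \<otimes> g = (inv g \<otimes> c \<otimes> g) \<otimes> (inv g \<otimes> c' \<otimes> g)"
    using assms by (simp add: m_assoc inv_mult_cancel)
  then show ?thesis
    using assms by (simp add: twist_def chi_mult gamma2.inv_op_closed1)
qed

lemma twist_conj:
  assumes "c \<in> lower_central G 2" "g \<in> carrier G" "h \<in> carrier G"
  shows "twist (inv g \<otimes> c \<otimes> g) h = twist c h"
proof -
  obtain w where w: "w \<in> lower_central G 3" "inv g \<otimes> c \<otimes> g = c \<otimes> w"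
    using conj_gamma2 assms by blast
  then show ?thesis
    using assms gamma3_subset_gamma2 by (auto simp: twist_mult_left twist_gamma3)
qed

lemma twist_mult_right:
  assumes "c \<in> lower_central G 2" "g \<in> carrier G" "h \<in> carrier G"
  shows "twist c (g \<otimes> h) = twist c g + twist c h"
proof -
  have "twist c (g \<otimes> h) = twist (inv g \<otimes> c \<otimes> g) h + twist c g"
    using assms by (simp add: twist_def m_assoc inv_mult_group)
  then show ?thesis
    using twist_conj[OF assms] by simp
qed

lemma twist_int_pow_left:
  assumes "c \<in> lower_central G 2" "g \<in> carrier G"
  shows "twist (c [^] (n :: int)) g = n \<odot>\<^sub>z twist c g"
proof -
  interpret S: group "G\<lparr>carrier := lower_central G 2\<rparr>"
    by (rule gamma2.subgroup_is_group[OF is_group])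
  show ?thesis
    using S.additive_int_pow[of "\<lambda>c. twist c g" c n] assms
    by (simp add: twist_mult_left int_pow_consistent[OF gamma2.subgroup_axioms])
qed

lemma twist_eq_chi_commutator:
  assumes "c \<in> lower_central G 2" "g \<in> carrier G"
  shows "twist c g = \<chi> (commutator G c g)"
proof -
  have c3: "commutator G c g \<in> lower_central G 3"
    by (rule commutator_in_gamma3[OF assms])
  have "inv g \<otimes> c \<otimes> g = inv g \<otimes> (commutator G c g \<otimes> g) \<otimes> c"
    using assms by (simp add: commutator_def m_assoc inv_mult_cancel)
  also have "\<dots> = commutator G c g \<otimes> c"
    using assms gamma3_closed[OF c3] gamma3_central[OF c3] by (simp add: m_assoc inv_mult_cancel)
  finally show ?thesis
    using assms c3 gamma3_subset_gamma2 by (auto simp: twist_def chi_mult)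
qed

text \<open>The commutator of the inverses of \<open>y\<close> and \<open>g\<close>. It is the
  correction factor in y g = g y (\<open>bracket y g\<close>), the form in which commutators arise
  when a power is moved to its place in a word.\<close>

definition bracket :: "'a \<Rightarrow> 'a \<Rightarrow> 'a" where
  "bracket y g = inv y \<otimes> inv g \<otimes> y \<otimes> g"

lemma bracket_in_gamma2: "y \<in> carrier G \<Longrightarrow> g \<in> carrier G \<Longrightarrow> bracket y g \<in> lower_central G 2"
  using commutator_in_gamma2[of "inv y" "inv g"] by (simp add: bracket_def commutator_def)

lemma bracket_mult:
  assumes "y \<in> carrier G" "g \<in> carrier G" "h \<in> carrier G"
  shows "bracket y (g \<otimes> h) = bracket y h \<otimes> (inv h \<otimes> bracket y g \<otimes> h)"
  using assms by (simp add: bracket_def m_assoc inv_mult_group inv_mult_cancel)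

lemma chi_bracket_mult:
  assumes "y \<in> carrier G" "g \<in> carrier G" "h \<in> carrier G"
  shows "\<chi> (bracket y (g \<otimes> h)) = \<chi> (bracket y g) + \<chi> (bracket y h) + twist (bracket y g) h"
  using assms
  by (simp add: bracket_mult chi_mult bracket_in_gamma2 gamma2.inv_op_closed1 twist_def)

lemma twist_bracket_mult:
  assumes "y \<in> carrier G" "g \<in> carrier G" "h \<in> carrier G" "k \<in> carrier G"
  shows "twist (bracket y (g \<otimes> h)) k = twist (bracket y g) k + twist (bracket y h) k"
  using assms
  by (simp add: bracket_mult twist_mult_left bracket_in_gamma2 gamma2.inv_op_closed1 twist_conj)

text \<open>By \<open>chi_bracket_mult\<close> the difference in direction g is a constant plus the
  additive map \<open>twist (bracket y g)\<close>, so the function is quadratic.\<close>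

lemma poly_lt_chi_bracket:
  assumes "y \<in> carrier G"
  shows "poly_lt G 3 (\<lambda>g. \<chi> (bracket y g))"
proof -
  have "poly_lt G (Suc 2) (\<lambda>g. \<chi> (bracket y g))"
  proof (rule poly_lt_SucI)
    fix g assume g: "g \<in> carrier G"
    have "poly_lt G 2 (\<lambda>h. \<chi> (bracket y g) + twist (bracket y g) h)"
    proof (rule poly_lt_add)
      show "poly_lt G 2 (twist (bracket y g))"
        by (rule poly_lt_additive) (use g assms in \<open>auto simp: twist_mult_right bracket_in_gamma2\<close>)
    qed (simp add: poly_lt_const)
    then show "poly_lt G 2 (\<lambda>h. \<chi> (bracket y (g \<otimes> h)) - \<chi> (bracket y h))"
      using g assms by (elim poly_lt_congI) (simp add: chi_bracket_mult)
  qed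
  then show ?thesis
    by simp
qed

lemma poly_lt_twist_bracket_word:
  assumes "y \<in> carrier G" "x ` set js \<subseteq> carrier G" "x ` set ks \<subseteq> carrier G"
  shows "poly_lt int_vectors 3 (\<lambda>m. twist (bracket y (word G x js m)) (word G x ks m))"
proof (rule int_vectors.poly_lt_biadditive
    [where B = "\<lambda>m n. twist (bracket y (word G x js m)) (word G x ks n)"])
  fix m n k :: "nat \<Rightarrow> int"
  show "twist (bracket y (word G x js (m \<otimes>\<^bsub>int_vectors\<^esub> n))) (word G x ks k) =
        twist (bracket y (word G x js m)) (word G x ks k) +
        twist (bracket y (word G x js n)) (word G x ks k)"
    using assms additive_word_add[of "\<lambda>g. twist (bracket y g) (word G x ks k)" x js m n]
    by (simp add: twist_bracket_mult)
  show "twist (bracket y (word G x js m)) (word G x ks (n \<otimes>\<^bsub>int_vectors\<^esub> k)) =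
        twist (bracket y (word G x js m)) (word G x ks n) +
        twist (bracket y (word G x js m)) (word G x ks k)"
    using assms additive_word_add[of "twist (bracket y (word G x js m))" x ks n k]
    by (simp add: twist_mult_right bracket_in_gamma2)
qed

text \<open>A word is not a homomorphism of its exponents, so \<open>poly_lt_chi_bracket\<close> can
  be pulled back only along one letter at a time. Splitting off a letter leaves a twist of that
  letter with the remaining word, which is the diagonal of a biadditive map.\<close>

lemma poly_lt_chi_bracket_word:
  assumes y: "y \<in> carrier G" and "x ` set js \<subseteq> carrier G"
  shows "poly_lt int_vectors 3 (\<lambda>m. \<chi> (bracket y (word G x js m)))"
  using assms(2)
proof (induction js)
  case Nil
  show ?case
    by (simp add: int_vectors.poly_lt_const)
next
  case (Cons i js)
  have hom: "(\<lambda>m. x i [^] m i) \<in> hom int_vectors G"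
    using Cons.prems by (auto simp: hom_def int_pow_mult)
  have "poly_lt int_vectors 3 (\<lambda>m. \<chi> (bracket y (x i [^] m i)) + \<chi> (bracket y (word G x js m)) +
          twist (bracket y (word G x [i] m)) (word G x js m))"
  proof (intro int_vectors.poly_lt_add)
    show "poly_lt int_vectors 3 (\<lambda>m. \<chi> (bracket y (x i [^] m i)))"
      by (rule poly_lt_pullback[OF int_vectors.monoid_axioms hom poly_lt_chi_bracket[OF y]])
    show "poly_lt int_vectors 3 (\<lambda>m. twist (bracket y (word G x [i] m)) (word G x js m))"
      using Cons.prems by (intro poly_lt_twist_bracket_word y) auto
  qed (use Cons in auto)
  then show ?case
    using Cons.prems y
    by (elim int_vectors.poly_lt_congI) (simp add: chi_bracket_mult)
qed

text \<open>
  The derivative of \<open>(g, n) \<mapsto> \<chi> (inv (word x n) \<otimes> g)\<close> in the direction \<open>(g, n)\<close> is the function of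
  \<open>m\<close> below. It satisfies a cocycle identity in \<open>(g, n)\<close>, so it needs to be computed only for powers
  of the \<open>x i\<close> and for elements of \<open>\<gamma>\<^sub>2\<close>.
\<close>

definition word_derivative ::
    "(nat \<Rightarrow> 'a) \<Rightarrow> nat list \<Rightarrow> 'a \<Rightarrow> (nat \<Rightarrow> int) \<Rightarrow> (nat \<Rightarrow> int) \<Rightarrow> circle" where
  "word_derivative x js g n m =
     \<chi> (inv (word G x js (\<lambda>i. n i + m i)) \<otimes> g \<otimes> word G x js m)"

lemma word_derivative_in_gamma2:
  assumes "x ` set js \<subseteq> carrier G" "g \<in> carrier G" "ab_class G (word G x js n) = ab_class G g"
  shows "inv (word G x js (\<lambda>i. n i + m i)) \<otimes> g \<otimes> word G x js m \<in> lower_central G 2"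
proof -
  interpret h: group_hom G "abelianization G" "ab_class G"
    by (rule group_hom_ab_class)
  have "ab_class G (word G x js (\<lambda>i. n i + m i)) = ab_class G (g \<otimes> word G x js m)"
    using assms by (simp add: ab_class_word_add)
  then have "inv (word G x js (\<lambda>i. n i + m i)) \<otimes> (g \<otimes> word G x js m) \<in> lower_central G 2"
    using assms by (subst (asm) ab_class_eq_iff) auto
  then show ?thesis
    using assms by (simp add: m_assoc)
qed

lemma word_derivative_mult:
  assumes x: "x ` set js \<subseteq> carrier G"
    and g: "g \<in> carrier G" "ab_class G (word G x js n) = ab_class G g"
    and g': "g' \<in> carrier G" "ab_class G (word G x js n') = ab_class G g'"
  shows "word_derivative x js (g \<otimes> g') (\<lambda>i. n i + n' i) m =
         word_derivative x js g n (\<lambda>i. n' i + m i) + word_derivative x js g' n' m"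
proof -
  let ?w = "\<lambda>n. word G x js n"
  have "inv (?w (\<lambda>i. n i + n' i + m i)) \<otimes> (g \<otimes> g') \<otimes> ?w m =
        (inv (?w (\<lambda>i. n i + (n' i + m i))) \<otimes> g \<otimes> ?w (\<lambda>i. n' i + m i)) \<otimes>
        (inv (?w (\<lambda>i. n' i + m i)) \<otimes> g' \<otimes> ?w m)"
    using x g g' by (simp add: m_assoc inv_mult_cancel add.assoc)
  then show ?thesis
    unfolding word_derivative_def
    using word_derivative_in_gamma2[OF x g, of "\<lambda>i. n' i + m i"]
      word_derivative_in_gamma2[OF x g', of m]
    by (simp add: chi_mult)
qed

lemma poly_lt_word_derivative_mult:
  assumes "x ` set js \<subseteq> carrier G"
    and "g \<in> carrier G" "ab_class G (word G x js n) = ab_class G g"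
    and "g' \<in> carrier G" "ab_class G (word G x js n') = ab_class G g'"
    and "poly_lt int_vectors m (word_derivative x js g n)"
    and "poly_lt int_vectors m (word_derivative x js g' n')"
  shows "poly_lt int_vectors m (word_derivative x js (g \<otimes> g') (\<lambda>i. n i + n' i))"
proof -
  \<comment> \<open>The shifted summand of the cocycle identity is the unshifted one plus a
    difference of it, whose degree is no larger.\<close>
  have "poly_lt int_vectors m (\<lambda>k. (word_derivative x js g n (n' \<otimes>\<^bsub>int_vectors\<^esub> k) -
          word_derivative x js g n k) + word_derivative x js g n k + word_derivative x js g' n' k)"
    using assms(6,7) int_vectors.poly_lt_Suc[OF assms(6)]
    by (intro int_vectors.poly_lt_add) auto
  then show ?thesis
    by (elim int_vectors.poly_lt_congI) (simp add: word_derivative_mult[OF assms(1-5)])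
qed

lemma poly_lt_word_derivative_gamma2:
  assumes "x ` set js \<subseteq> carrier G" "c \<in> lower_central G 2"
  shows "poly_lt int_vectors 3 (word_derivative x js c (\<lambda>i. 0))"
proof -
  have "poly_lt int_vectors 2 (\<lambda>m. twist c (word G x js m))"
    using assms
    by (intro int_vectors.poly_lt_additive) (auto simp: additive_word_add twist_mult_right)
  then have "poly_lt int_vectors 3 (\<lambda>m. twist c (word G x js m) + \<chi> c)"
    by (intro int_vectors.poly_lt_add int_vectors.poly_lt_const
        int_vectors.poly_lt_mono[of 2 3]) auto
  then show ?thesis
    by (elim int_vectors.poly_lt_congI) (simp add: word_derivative_def twist_def)
qed

text \<open>The two words differ only at letter \<open>i\<close>. After cancellation what remains is
  the bracket of the power with the prefix \<open>?P\<close>, conjugated by the rest of the word;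
  its character value is a bracket term plus a twist, both quadratic.\<close>

lemma poly_lt_word_derivative_int_pow:
  assumes x: "x ` set js \<subseteq> carrier G" and js: "distinct js" "i \<in> set js"
  shows "poly_lt int_vectors 3 (word_derivative x js (x i [^] (s :: int)) (\<lambda>j. if j = i then s else 0))"
proof -
  obtain ps qs where js_eq: "js = ps @ i # qs"
    using split_list[OF js(2)] by blast
  let ?y = "x i [^] s" and ?e = "\<lambda>j. if j = i then s else 0"
  let ?P = "\<lambda>m. word G x ps m" and ?Q = "\<lambda>m. word G x qs m"
  have closed: "x i \<in> carrier G" "x ` set ps \<subseteq> carrier G" "x ` set qs \<subseteq> carrier G"
    using x js_eq by auto
  have "word_derivative x js ?y ?e m =
          \<chi> (bracket ?y (?P m)) + twist (bracket ?y (?P m)) (word G x (i # qs) m)" for m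
  proof -
    have P: "word G x ps (\<lambda>j. ?e j + m j) = ?P m"
      using js(1) js_eq by (intro word_cong) auto
    have Q: "word G x qs (\<lambda>j. ?e j + m j) = ?Q m"
      using js(1) js_eq by (intro word_cong) auto
    have "word G x js (\<lambda>j. ?e j + m j) = ?P m \<otimes> (?y \<otimes> x i [^] m i \<otimes> ?Q m)"
      using x closed by (simp add: js_eq word_append P Q int_pow_mult)
    moreover have "word G x js m = ?P m \<otimes> (x i [^] m i \<otimes> ?Q m)"
      using x closed by (simp add: js_eq word_append)
    ultimately have "inv (word G x js (\<lambda>j. ?e j + m j)) \<otimes> ?y \<otimes> word G x js m =
        inv (word G x (i # qs) m) \<otimes> bracket ?y (?P m) \<otimes> word G x (i # qs) m"
      using closed by (simp add: bracket_def m_assoc inv_mult_group)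
    then show ?thesis
      by (simp add: word_derivative_def twist_def)
  qed
  moreover have "poly_lt int_vectors 3 (\<lambda>m. \<chi> (bracket ?y (?P m)) +
                   twist (bracket ?y (?P m)) (word G x (i # qs) m))"
    using closed
    by (intro int_vectors.poly_lt_add poly_lt_chi_bracket_word poly_lt_twist_bracket_word) auto
  ultimately show ?thesis
    by (elim int_vectors.poly_lt_congI)
qed

text \<open>The element is assembled letter by letter by the cocycle identity while the reference
  word over \<open>js\<close> stays fixed. The equation of classes is carried along because that
  identity presupposes it.\<close>

lemma poly_lt_word_derivative_word:
  assumes x: "x ` set js \<subseteq> carrier G" and js: "distinct js" and "distinct ks" "set ks \<subseteq> set js"
  shows "poly_lt int_vectors 3
           (word_derivative x js (word G x ks n) (\<lambda>i. if i \<in> set ks then n i else 0)) \<and>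
         ab_class G (word G x js (\<lambda>i. if i \<in> set ks then n i else 0)) = ab_class G (word G x ks n)"
  using assms(3,4)
proof (induction ks)
  case Nil
  then show ?case
    using poly_lt_word_derivative_gamma2[OF x, of \<one>] by (simp add: word_zero)
next
  case (Cons i ks)
  interpret h: group_hom G "abelianization G" "ab_class G"
    by (rule group_hom_ab_class)
  let ?e = "\<lambda>j. if j = i then n i else 0" and ?n = "\<lambda>j. if j \<in> set ks then n j else 0"
  have closed: "x i \<in> carrier G" "x ` set ks \<subseteq> carrier G"
    using Cons.prems x by auto
  have IH: "poly_lt int_vectors 3 (word_derivative x js (word G x ks n) ?n)"
    "ab_class G (word G x js ?n) = ab_class G (word G x ks n)"
    using Cons by auto
  obtain ps qs where js_eq: "js = ps @ i # qs"
    using split_list[of i js] Cons.prems by auto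
  have "word G x ps ?e = \<one>" "word G x qs ?e = \<one>"
    using js js_eq by (auto intro!: word_zero)
  then have e: "word G x js ?e = x i [^] n i"
    using x js_eq closed by (simp add: word_append)
  have "(\<lambda>j. if j \<in> set (i # ks) then n j else 0) = (\<lambda>j. ?e j + ?n j)"
    using Cons.prems by auto
  moreover have "poly_lt int_vectors 3
      (word_derivative x js (x i [^] n i \<otimes> word G x ks n) (\<lambda>j. ?e j + ?n j))"
    using Cons.prems closed IH e
    by (intro poly_lt_word_derivative_mult x poly_lt_word_derivative_int_pow js) auto
  moreover have "ab_class G (word G x js (\<lambda>j. ?e j + ?n j)) = ab_class G (x i [^] n i \<otimes> word G x ks n)"
    using closed x IH(2) e by (simp only: ab_class_word_add[OF x] h.hom_mult word_closed int_pow_closed)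
  ultimately show ?case
    by simp
qed

text \<open>Here \<open>g\<close> is factored as the word with exponents \<open>n\<close> times an
  element of \<open>\<gamma>\<^sub>2\<close>; the latter gets the exponent vector 0.\<close>

lemma poly_lt_word_derivative:
  assumes x: "x ` set js \<subseteq> carrier G" and js: "distinct js"
    and g: "g \<in> carrier G" "ab_class G (word G x js n) = ab_class G g"
  shows "poly_lt int_vectors 3 (word_derivative x js g n)"
proof -
  let ?w = "word G x js n" and ?n = "\<lambda>i. if i \<in> set js then n i else 0"
  let ?c = "inv ?w \<otimes> g"
  have n: "word G x js (\<lambda>i. ?n i + m i) = word G x js (\<lambda>i. n i + m i)" for m
    by (rule word_cong) simp
  have c: "?c \<in> lower_central G 2"
    using ab_class_eq_iff[of ?w g] x g by simp
  have "poly_lt int_vectors 3 (word_derivative x js (?w \<otimes> ?c) (\<lambda>i. ?n i + 0))"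
  proof (rule poly_lt_word_derivative_mult[OF x])
    have "ab_class G \<one> = ab_class G ?c"
      using c x g by (subst ab_class_eq_iff) auto
    then show "ab_class G (word G x js (\<lambda>i. 0)) = ab_class G ?c"
      by (simp add: word_zero)
  qed (use poly_lt_word_derivative_word[OF x js js, of n] poly_lt_word_derivative_gamma2[OF x c]
        x g in auto)
  then show ?thesis
    using x g by (simp add: word_derivative_def[abs_def] inv_mult_cancel n)
qed

text \<open>\<open>H\<close> parametrizes group elements together with compatible exponent vectors.
  The difference in direction u is a word derivative, quadratic by
  \<open>poly_lt_word_derivative\<close>, so the function itself is cubic.\<close>

theorem poly_lt_chi_word:
  assumes "monoid H" and p: "p \<in> hom H G" and v: "v \<in> hom H int_vectors"
    and x: "x ` set js \<subseteq> carrier G" and js: "distinct js"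
    and eq: "\<And>u. u \<in> carrier H \<Longrightarrow> ab_class G (word G x js (v u)) = ab_class G (p u)"
  shows "poly_lt H 4 (\<lambda>u. \<chi> (inv (word G x js (v u)) \<otimes> p u))"
proof -
  interpret H: monoid H
    by fact
  let ?F = "\<lambda>u. \<chi> (inv (word G x js (v u)) \<otimes> p u)"
  have "poly_lt H (Suc 3) ?F"
  proof (rule poly_lt_SucI)
    fix u assume u: "u \<in> carrier H"
    have pu: "p u \<in> carrier G"
      using hom_in_carrier[OF p u] .
    have "poly_lt H 3 (\<lambda>w. word_derivative x js (p u) (v u) (v w))"
      by (rule poly_lt_pullback[OF assms(1) v poly_lt_word_derivative[OF x js pu eq[OF u]]])
    then show "poly_lt H 3 (\<lambda>w. ?F (u \<otimes>\<^bsub>H\<^esub> w) - ?F w)"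
    proof (rule H.poly_lt_congI)
      fix w assume w: "w \<in> carrier H"
      have pw: "p w \<in> carrier G"
        using hom_in_carrier[OF p w] .
      have vw: "v (u \<otimes>\<^bsub>H\<^esub> w) = (\<lambda>i. v u i + v w i)"
        using hom_mult[OF v u w] by simp
      have c: "inv (word G x js (v w)) \<otimes> p w \<in> lower_central G 2"
        using ab_class_eq_iff[of "word G x js (v w)" "p w"] eq[OF w] x pw by simp
      have "inv (word G x js (v (u \<otimes>\<^bsub>H\<^esub> w))) \<otimes> p (u \<otimes>\<^bsub>H\<^esub> w) =
            (inv (word G x js (\<lambda>i. v u i + v w i)) \<otimes> p u \<otimes> word G x js (v w)) \<otimes>
            (inv (word G x js (v w)) \<otimes> p w)"
        using x pu pw by (simp add: vw hom_mult[OF p u w] m_assoc inv_mult_cancel)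
      then show "?F (u \<otimes>\<^bsub>H\<^esub> w) - ?F w = word_derivative x js (p u) (v u) (v w)"
        using word_derivative_in_gamma2[OF x pu eq[OF u], of "v w"] c
        by (simp add: chi_mult word_derivative_def)
    qed
  qed
  then show ?thesis
    by simp
qed

text \<open>The shift inserts a power of \<open>x i [^] d\<close>, an element of
  \<open>\<gamma>\<^sub>2\<close>, right after the letter \<open>i\<close>. Extracting it costs its
  character value and, for passing the later letters \<open>qs\<close>, the twists with
  them.\<close>

lemma chi_word_shift:
  assumes x: "x ` set js \<subseteq> carrier G" and js: "distinct js" "js = ps @ i # qs"
    and d: "x i [^] (d :: int) \<in> lower_central G 2"
    and g: "g \<in> carrier G" "ab_class G (word G x js n) = ab_class G g"
  shows "\<chi> (inv (word G x js (n(i := n i + s * d))) \<otimes> g) =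
         \<chi> (inv (word G x js n) \<otimes> g) - s \<odot>\<^sub>z \<chi> (x i [^] d) -
         (\<Sum>j\<in>set qs. (s * n j) \<odot>\<^sub>z twist (x i [^] d) (x j))"
proof -
  let ?P = "word G x ps n" and ?Q = "word G x qs n" and ?q = "(x i [^] d) [^] s"
  have closed: "x i \<in> carrier G" "x ` set ps \<subseteq> carrier G" "x ` set qs \<subseteq> carrier G"
    using x js by auto
  have q: "?q \<in> lower_central G 2"
    by (rule subgroup_int_pow_closed[OF gamma2.subgroup_axioms d])
  have P: "word G x ps (n(i := t)) = ?P" and Q: "word G x qs (n(i := t)) = ?Q" for t
    using js by (auto intro!: word_cong)
  have "word G x js (n(i := n i + s * d)) = ?P \<otimes> (x i [^] n i \<otimes> ?q \<otimes> ?Q)"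
    using x closed by (simp add: js(2) word_append P Q int_pow_mult int_pow_pow mult.commute)
  moreover have w: "word G x js n = ?P \<otimes> (x i [^] n i \<otimes> ?Q)"
    using x closed by (simp add: js(2) word_append)
  ultimately have "inv (word G x js (n(i := n i + s * d))) \<otimes> g =
      inv (inv ?Q \<otimes> ?q \<otimes> ?Q) \<otimes> (inv (word G x js n) \<otimes> g)"
    using closed g by (simp add: m_assoc inv_mult_group inv_mult_cancel)
  moreover have "inv (word G x js n) \<otimes> g \<in> lower_central G 2"
    using ab_class_eq_iff[of "word G x js n" g] g x by simp
  ultimately have "\<chi> (inv (word G x js (n(i := n i + s * d))) \<otimes> g) =
      \<chi> (inv (word G x js n) \<otimes> g) - (\<chi> ?q + twist ?q ?Q)"
    using q closed by (simp add: chi_mult chi_inv gamma2.inv_op_closed1 twist_def)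
  also have "\<chi> ?q = s \<odot>\<^sub>z \<chi> (x i [^] d)"
    using d by (rule chi_int_pow)
  also have "twist ?q ?Q = s \<odot>\<^sub>z (\<Sum>j\<in>set qs. n j \<odot>\<^sub>z twist (x i [^] d) (x j))"
    using additive_word[of "twist (x i [^] d)" x qs n] closed js d
    by (simp add: twist_int_pow_left twist_mult_right)
  finally show ?thesis
    by (simp only: zmul_sum_right zmul_zmul diff_diff_eq)
qed

end


section \<open>Coordinates in sums of cyclic groups\<close>

lemma (in comm_group) word_eq_finprod:
  "x ` set js \<subseteq> carrier G \<Longrightarrow> distinct js \<Longrightarrow> word G x js n = (\<Otimes>i\<in>set js. x i [^] n i)"
proof (induction js)
  case (Cons i js)
  have "(\<Otimes>j\<in>insert i (set js). x j [^] n j) = x i [^] n i \<otimes> (\<Otimes>j\<in>set js. x j [^] n j)"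
    using Cons.prems by (intro finprod_insert) auto
  then show ?case
    using Cons by simp
qed simp

locale cyclic_sum =
  fixes A :: "('a, 'b) monoid_scheme" and js :: "nat list" and n :: "nat \<Rightarrow> nat" and a :: "nat \<Rightarrow> 'a"
  assumes sum: "is_cyclic_sum A (set js) n a"
    and distinct: "distinct js"
    and orders: "\<And>i. i \<in> set js \<Longrightarrow> 1 < n i"
begin

sublocale comm_group A
  using sum by (simp add: is_cyclic_sum_def)

lemma gens_closed: "a ` set js \<subseteq> carrier A"
  using sum by (auto simp: is_cyclic_sum_def)

abbreviation "PG \<equiv> product_group (set js) (\<lambda>i. integer_mod_group (n i))"

lemma group_hom_sum_map: "group_hom PG A (cyclic_sum_map A (set js) a)"
  using sum by (intro group_hom.intro group_hom_axioms.intro)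
    (auto simp: is_cyclic_sum_def iso_def intro: is_group simp del: carrier_product_group
      mult_product_group one_product_group)

lemma bij_betw_sum_map: "bij_betw (cyclic_sum_map A (set js) a) (carrier PG) (carrier A)"
  using sum by (simp add: is_cyclic_sum_def iso_def)

lemma orders_pos: "i \<in> set js \<Longrightarrow> 0 < n i"
  using orders by fastforce

lemma carrier_PG: "carrier PG = (\<Pi>\<^sub>E i\<in>set js. {0..<int (n i)})"
  unfolding carrier_product_group
  by (intro PiE_cong) (auto simp: carrier_integer_mod_group dest: orders_pos)

lemma sum_map_eq_word: "cyclic_sum_map A (set js) a m = word A a js m"
  by (simp add: cyclic_sum_map_def word_eq_finprod[OF gens_closed distinct])

lemma gens_pow:
  assumes "i \<in> set js"
  shows "a i [^]\<^bsub>A\<^esub> int (n i) = \<one>\<^bsub>A\<^esub>"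
proof -
  interpret f: group_hom PG A "cyclic_sum_map A (set js) a"
    by (rule group_hom_sum_map)
  \<comment> \<open>\<open>?e s\<close> is \<open>s\<close> times the unit vector at
    \<open>i\<close>. As \<open>1 < n i\<close>, both 1 and \<open>n i - 1\<close> are admissible
    residues; they add up to zero in the product, so their images multiply to the identity.\<close>
  let ?e = "\<lambda>s. \<lambda>j\<in>set js. if j = i then s else 0 :: int"
  have e: "?e s \<in> carrier PG" if "0 \<le> s" "s < int (n i)" for s
    unfolding carrier_PG using that orders_pos by (auto intro!: restrict_PiE)
  have w: "cyclic_sum_map A (set js) a (?e s) = a i [^]\<^bsub>A\<^esub> s" for s
  proof -
    have "word A a js (?e s) = (\<Otimes>\<^bsub>A\<^esub>j\<in>set js. if i = j then a j [^]\<^bsub>A\<^esub> s else \<one>\<^bsub>A\<^esub>)"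
      unfolding word_eq_finprod[OF gens_closed distinct]
      using gens_closed by (intro finprod_cong') auto
    also have "\<dots> = a i [^]\<^bsub>A\<^esub> s"
      using assms gens_closed by (intro finprod_singleton) auto
    finally show ?thesis
      by (simp add: sum_map_eq_word)
  qed
  have "?e 1 \<otimes>\<^bsub>PG\<^esub> ?e (int (n i) - 1) = \<one>\<^bsub>PG\<^esub>"
    by (auto simp: fun_eq_iff)
  then have "cyclic_sum_map A (set js) a (?e 1) \<otimes>\<^bsub>A\<^esub> cyclic_sum_map A (set js) a (?e (int (n i) - 1)) = \<one>\<^bsub>A\<^esub>"
    using f.hom_mult[OF e[of 1] e[of "int (n i) - 1"]] f.hom_one orders[OF assms] by simp
  then show ?thesis
    using assms gens_closed int_pow_mult[of "a i" 1 "int (n i) - 1"] by (auto simp: w)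
qed

lemma ex_word:
  assumes "y \<in> carrier A"
  obtains m where "word A a js m = y"
  using bij_betw_sum_map assms sum_map_eq_word by (metis bij_betw_imp_surj_on imageE)

lemma word_mod: "word A a js (\<lambda>i\<in>set js. m i mod int (n i)) = word A a js m"
proof -
  have "a i [^]\<^bsub>A\<^esub> (m i mod int (n i)) = a i [^]\<^bsub>A\<^esub> m i" if "i \<in> set js" for i
  proof -
    have ai: "a i \<in> carrier A"
      using that gens_closed by auto
    have "a i [^]\<^bsub>A\<^esub> m i = (a i [^]\<^bsub>A\<^esub> int (n i)) [^]\<^bsub>A\<^esub> (m i div int (n i)) \<otimes>\<^bsub>A\<^esub> a i [^]\<^bsub>A\<^esub> (m i mod int (n i))"
      using ai by (simp add: int_pow_pow flip: int_pow_mult)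
    then show ?thesis
      using ai gens_pow[OF that] by simp
  qed
  then show ?thesis
    unfolding word_eq_finprod[OF gens_closed distinct]
    using gens_closed by (intro finprod_cong') auto
qed

lemma word_eq_one_imp_dvd:
  assumes "word A a js m = \<one>\<^bsub>A\<^esub>" "i \<in> set js"
  shows "int (n i) dvd m i"
proof -
  let ?m = "\<lambda>i\<in>set js. m i mod int (n i)" and ?z = "\<lambda>i\<in>set js. 0 :: int"
  have "?m \<in> carrier PG" "?z \<in> carrier PG"
    unfolding carrier_PG using orders_pos by (auto intro!: restrict_PiE)
  moreover have "word A a js ?z = \<one>\<^bsub>A\<^esub>"
    by (rule word_zero) simp
  then have "cyclic_sum_map A (set js) a ?m = cyclic_sum_map A (set js) a ?z"
    using assms(1) word_mod[of m] by (simp add: sum_map_eq_word)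
  ultimately have "?m = ?z"
    using bij_betw_sum_map unfolding bij_betw_def inj_on_def by blast
  then show ?thesis
    using assms(2) by (auto simp: fun_eq_iff dvd_eq_mod_eq_0 split: if_splits)
qed

end


section \<open>Tahara's groups\<close>

definition idx :: "nat list" where
  "idx = [1, 2, 3, 4]"

lemma set_idx [simp]: "set idx = {1..4}" and distinct_idx [simp]: "distinct idx"
  by (auto simp: idx_def)

lemma in_1_4_iff: "i \<in> {1..4} \<longleftrightarrow> i = 1 \<or> i = 2 \<or> i = 3 \<or> i = (4::nat)"
  by auto

context tahara_group
begin

text \<open>The orders of the cyclic summands of the abelianization; \<open>e\<close> below plays
  the same role for the quotient of \<open>\<gamma>\<^sub>2\<close> by
  \<open>\<gamma>\<^sub>3\<close>.\<close>

definition d :: "nat \<Rightarrow> nat" where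
  "d i = [2 ^ k, 2 ^ (k + 2), 2 ^ (k + 4), 2 ^ (k + 4)] ! (i - 1)"

definition e :: "nat \<Rightarrow> nat" where
  "e i = [4, 2 ^ k, 2 ^ (k + 2), 2 ^ (k + 4)] ! (i - 1)"

definition h :: 'a where
  "h = x2 4 [^] ((2::nat) ^ (k + 5))"

sublocale class_three_group G
  using class_three by unfold_locales (simp add: has_nilpotency_class_def)

lemma x1_in_carrier [simp]: "i \<in> {1..4} \<Longrightarrow> x1 i \<in> carrier G"
  using x1_closed by blast

lemma x2_in_gamma2 [simp]: "i \<in> {1..4} \<Longrightarrow> x2 i \<in> lower_central G 2"
  using x2_gamma2 by blast

lemma x1_list: "x1 ` set idx \<subseteq> carrier G"
  using x1_closed by simp

lemma x2_list: "x2 ` set idx \<subseteq> lower_central G 2"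
  using x2_gamma2 by simp

sublocale ab: cyclic_sum "abelianization G" idx d "\<lambda>i. ab_class G (x1 i)"
proof
  show "is_cyclic_sum (abelianization G) (set idx) d (\<lambda>i. ab_class G (x1 i))"
    unfolding set_idx d_def[abs_def] by (rule ab_sum)
  show "1 < d i" if "i \<in> set idx" for i
  proof -
    have "1 < (2::nat) ^ k"
      using k_ge_2 by (intro one_less_power) auto
    then have *: "1 < c * (2::nat) ^ k" if "0 < c" for c
      by (rule less_le_trans) (use that in simp)
    have "d i = 1 * 2 ^ k \<or> d i = 4 * 2 ^ k \<or> d i = 16 * 2 ^ k"
      using that unfolding set_idx in_1_4_iff by (auto simp: d_def power_add)
    then show ?thesis
      by (elim disjE) (simp only: *[OF zero_less_one] *[OF zero_less_numeral])+
  qed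
qed simp

sublocale G2: comm_group "G\<lparr>carrier := lower_central G 2\<rparr>"
  using subgroup.subgroup_is_group[OF gamma2.subgroup_axioms is_group] gamma2_commute
  by (intro group.group_comm_groupI) auto

sublocale g23: cyclic_sum "gamma23 G" idx e "\<lambda>j. gamma3_class G (x2 j)"
proof
  show "is_cyclic_sum (gamma23 G) (set idx) e (\<lambda>j. gamma3_class G (x2 j))"
    unfolding set_idx e_def[abs_def] by (rule gamma23_sum)
  show "1 < e i" if "i \<in> set idx" for i
  proof -
    have "1 < (2::nat) ^ k"
      using k_ge_2 by (intro one_less_power) auto
    then have *: "1 < c * (2::nat) ^ k" if "0 < c" for c
      by (rule less_le_trans) (use that in simp)
    have "e i = 4 \<or> e i = 1 * 2 ^ k \<or> e i = 4 * 2 ^ k \<or> e i = 16 * 2 ^ k"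
      using that unfolding set_idx in_1_4_iff by (auto simp: e_def power_add)
    then show ?thesis
    proof (elim disjE)
      show "1 < e i" if "e i = 4"
        using that by simp
    qed (simp only: *[OF zero_less_one] *[OF zero_less_numeral])+
  qed
qed simp

lemma gamma3_normal_gamma2: "lower_central G 3 \<lhd> G\<lparr>carrier := lower_central G 2\<rparr>"
  using G2.normal_iff_subgroup gamma3_subset_gamma2
    subgroup_incl[OF gamma3_subgroup gamma2.subgroup_axioms] by blast

lemma ab_class_word:
  "ab_class G (word G x1 idx n) =
   word (abelianization G) (\<lambda>i. ab_class G (x1 i)) idx n"
  using group_hom.hom_word[OF group_hom_ab_class x1_list] .

lemma ex_ab_class_word:
  assumes "g \<in> carrier G"
  obtains n where "ab_class G (word G x1 idx n) = ab_class G g"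
  using ab.ex_word[of "ab_class G g"] ab_class_word hom_in_carrier[OF ab_class_hom assms] by metis

lemma ab_class_word_eq_imp_dvd:
  assumes "ab_class G (word G x1 idx m) = ab_class G (word G x1 idx n)" "i \<in> {1..4}"
  shows "int (d i) dvd n i - m i"
proof -
  let ?w = "word (abelianization G) (\<lambda>i. ab_class G (x1 i)) idx"
  have "?w (\<lambda>i. m i + (n i - m i)) = ?w m \<otimes>\<^bsub>abelianization G\<^esub> ?w (\<lambda>i. n i - m i)"
    by (rule ab.word_add[OF ab.gens_closed])
  moreover have "?w m \<in> carrier (abelianization G)" "?w (\<lambda>i. n i - m i) \<in> carrier (abelianization G)"
    by (rule ab.word_closed[OF ab.gens_closed])+
  ultimately have "?w (\<lambda>i. n i - m i) = \<one>\<^bsub>abelianization G\<^esub>"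
    using assms(1) ab.l_cancel_one' by (simp add: ab_class_word)
  then show ?thesis
    using ab.word_eq_one_imp_dvd assms(2) unfolding set_idx by blast
qed

lemma x1_pow_gamma2:
  assumes "i \<in> {1..4}"
  shows "x1 i [^] int (d i) \<in> lower_central G 2"
proof -
  interpret f: group_hom G "abelianization G" "ab_class G"
    by (rule group_hom_ab_class)
  have "ab_class G (x1 i [^] int (d i)) = \<one>\<^bsub>abelianization G\<^esub>"
    using ab.gens_pow[of i] assms by (simp add: f.hom_int_pow)
  also have "\<dots> = ab_class G \<one>"
    by simp
  finally show ?thesis
    using assms by (subst (asm) eq_commute, subst (asm) ab_class_eq_iff) auto
qed

text \<open>Translates the orders in \<open>pair_value\<close> into the explicit \<open>d\<close>.
  One divisibility is the relation for the generator; the other comes from the exponent vector with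
  the order at position \<open>i\<close>, by uniqueness of coordinates.\<close>

lemma ab_order_x1:
  assumes "i \<in> {1..4}"
  shows "ab_order G (x1 i) = d i"
proof -
  let ?a = "\<lambda>i. ab_class G (x1 i)"
  have a: "?a i \<in> carrier (abelianization G)"
    using assms hom_in_carrier[OF ab_class_hom] by simp
  have i: "i \<in> set idx"
    using assms by simp
  have "int (ab_order G (x1 i)) dvd int (d i)"
    using ab.gens_pow[OF i] ab.int_pow_eq_id[OF a] by (simp add: ab_order_def)
  moreover have "int (d i) dvd int (ab_order G (x1 i))"
  proof -
    let ?m = "\<lambda>j. if i = j then int (ab_order G (x1 i)) else 0"
    have "word (abelianization G) ?a idx ?m =
          (\<Otimes>\<^bsub>abelianization G\<^esub>j\<in>set idx. if i = j then ?a j [^]\<^bsub>abelianization G\<^esub> int (ab_order G (x1 i))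
             else \<one>\<^bsub>abelianization G\<^esub>)"
      unfolding ab.word_eq_finprod[OF ab.gens_closed ab.distinct]
      using ab.gens_closed by (intro ab.finprod_cong') auto
    also have "\<dots> = ?a i [^]\<^bsub>abelianization G\<^esub> int (ab_order G (x1 i))"
      using i ab.gens_closed by (intro ab.finprod_singleton) auto
    also have "\<dots> = \<one>\<^bsub>abelianization G\<^esub>"
      using ab.int_pow_eq_id[OF a] by (simp add: ab_order_def)
    finally show ?thesis
      using ab.word_eq_one_imp_dvd[OF _ i] by fastforce
  qed
  ultimately show ?thesis
    by (simp add: dvd_antisym)
qed

lemma z_closed: "z \<in> carrier G"
  using gamma2_closed[OF x2_in_gamma2[of 1]] unfolding z_def by simp

lemma z_pow_T: "z [^] (int T * s) = \<one>"
  using int_pow_eq_id[OF z_closed] ord_z by simp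

lemma T_eq: "T = 4 * 2 ^ (k + 2)"
  by (simp add: T_def power_add)

text \<open>All pair values are powers of \<open>z [^] (T div 4)\<close>. This uniform bound is why
  congruence modulo 4 is the condition on the auxiliary vectors later on.\<close>

lemma pair_value_pow_4:
  assumes "i \<in> {1..4}" "j \<in> {1..4}" "i < j"
  shows "pair_value G (x1 i) (x1 j) [^] (4::int) = \<one>"
proof -
  have "(i, j) \<in> {(1, 2), (1, 3), (2, 3), (1, 4), (2, 4), (3, 4)}"
    using assms by auto
  moreover have "(z [^] (T div 4)) [^] (4::int) = \<one>"
    using z_closed z_pow_T[of 1] by (simp add: T_eq int_pow_pow mult.commute flip: int_pow_int)
  moreover have "(z [^] (- int (T div 2))) [^] (4::int) = \<one>"
    using z_closed z_pow_T[of "-2"] by (simp add: T_eq int_pow_pow mult.commute)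
  moreover have "(z [^] (- int (T div 4))) [^] (4::int) = \<one>"
    using z_closed z_pow_T[of "-1"] by (simp add: T_eq int_pow_pow mult.commute)
  ultimately show ?thesis
    using pair_values by auto
qed

lemma d_dvd_d: "i \<in> {1..4} \<Longrightarrow> j \<in> {1..4} \<Longrightarrow> i < j \<Longrightarrow> d i dvd d j"
  unfolding in_1_4_iff by (auto simp: d_def power_add)

lemma chi_pair_value:
  assumes "gamma2_character G \<chi>" "i \<in> {1..4}" "j \<in> {1..4}" "i < j"
  shows "int (4 * (d j div d i)) \<odot>\<^sub>z \<chi> (commutator G (x1 i [^] int (d i)) (x1 j)) = 0"
proof -
  interpret gamma2_character G \<chi>
    by fact
  let ?c = "commutator G (x1 i [^] int (d i)) (x1 j)"
  have c: "?c \<in> lower_central G 2"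
    using assms by (intro commutator_in_gamma2) auto
  have "(?c [^] int (d j div d i)) [^] (4::int) = \<one>"
    using pair_value_pow_4[OF assms(2-4)] assms
    by (simp add: pair_value_def ab_order_x1 flip: int_pow_int)
  then have "\<chi> (?c [^] (int (d j div d i) * 4)) = 0"
    using c chi_one by (simp add: int_pow_pow)
  then show ?thesis
    using c by (simp add: chi_int_pow mult.commute)
qed

lemma h_eq_z: "h = z [^] int (2 ^ (k + 3))"
  using h_eq unfolding h_def int_pow_int by (simp add: T_def power_add mult.commute)

lemma h_closed: "h \<in> carrier G"
  by (simp add: h_eq_z z_closed)

lemma h_dimension_subgroup: "h \<in> dimension_subgroup 4 G"
  using h_dim by (simp add: h_def)

section \<open>Words in the elements \<open>x2 j\<close> of the second lower central term\<close>

lemma gamma3_class_hom: "gamma3_class G \<in> hom (G\<lparr>carrier := lower_central G 2\<rparr>) (gamma23 G)"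
  using normal.r_coset_hom_Mod[OF gamma3_normal_gamma2]
  by (simp add: gamma23_def gamma3_class_def[abs_def] r_coset_def)

lemma gamma3_class_eq_iff:
  assumes "b \<in> lower_central G 2" "c \<in> lower_central G 2"
  shows "gamma3_class G b = gamma3_class G c \<longleftrightarrow> inv b \<otimes> c \<in> lower_central G 3"
  using normal.r_coset_eq_iff[OF gamma3_normal_gamma2, of b c] assms
    m_inv_consistent[OF gamma2.subgroup_axioms]
  by (simp add: gamma3_class_def r_coset_def)

abbreviation \<Gamma> :: "('a, 'b) monoid_scheme" where
  "\<Gamma> \<equiv> G\<lparr>carrier := lower_central G 2\<rparr>"

lemma group_hom_gamma3_class: "group_hom \<Gamma> (gamma23 G) (gamma3_class G)"
  using gamma3_class_hom G2.is_group g23.is_group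
  by (simp add: group_hom_def group_hom_axioms_def)

lemma int_pow_Gamma: "c \<in> lower_central G 2 \<Longrightarrow> c [^]\<^bsub>\<Gamma>\<^esub> (n :: int) = c [^] n"
  using int_pow_consistent[OF gamma2.subgroup_axioms] by simp

lemma gamma3_eq_powers: "w \<in> lower_central G 3 \<longleftrightarrow> (\<exists>s::int. w = z [^] s)"
  unfolding gamma3_generate using generate_pow[OF z_closed] by auto

text \<open>Coordinates modulo \<open>\<gamma>\<^sub>3\<close> leave an error
  \<open>z [^] s\<close>. Since \<open>z\<close> is the fourth power of \<open>x2 1\<close>, adding
  \<open>4 * s\<close> to the first exponent absorbs it.\<close>

lemma ex_word_gamma2:
  assumes "c \<in> lower_central G 2"
  obtains m where "word \<Gamma> x2 idx m = c"
proof -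
  interpret f: group_hom \<Gamma> "gamma23 G" "gamma3_class G"
    by (rule group_hom_gamma3_class)
  obtain m where "word (gamma23 G) (\<lambda>j. gamma3_class G (x2 j)) idx m = gamma3_class G c"
    using g23.ex_word[OF f.hom_closed] assms by force
  then have "gamma3_class G (word \<Gamma> x2 idx m) = gamma3_class G c"
    using f.hom_word[of x2 idx m] x2_list by simp
  moreover have w: "word \<Gamma> x2 idx m \<in> lower_central G 2"
    using G2.word_closed[of x2 idx m] x2_list by simp
  ultimately obtain s :: int where s: "inv (word \<Gamma> x2 idx m) \<otimes> c = z [^] s"
    using gamma3_class_eq_iff[OF w assms] gamma3_eq_powers by auto
  let ?e = "\<lambda>j. if j = 1 then 4 * s else 0"
  have "word \<Gamma> x2 idx ?e = x2 1 [^] (4 * s)"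
    using int_pow_Gamma[of "x2 1"] by (simp add: idx_def)
  also have "\<dots> = z [^] s"
    using gamma2_closed[OF x2_in_gamma2[of 1]] int_pow_pow[of "x2 1" 4 s] int_pow_int[of G "x2 1" 4]
    by (simp add: z_def)
  finally have "word \<Gamma> x2 idx (\<lambda>j. m j + ?e j) = word \<Gamma> x2 idx m \<otimes> z [^] s"
    using G2.word_add[of x2 idx m ?e] x2_list by simp
  also have "\<dots> = c"
    using w assms gamma2_closed by (simp flip: s add: inv_mult_cancel)
  finally show ?thesis
    using that by blast
qed


lemma x2_pow_gamma3:
  assumes "i \<in> {1..4}"
  shows "x2 i [^] int (e i) \<in> lower_central G 3"
proof -
  interpret f: group_hom \<Gamma> "gamma23 G" "gamma3_class G"
    by (rule group_hom_gamma3_class)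
  have "gamma3_class G (x2 i [^]\<^bsub>\<Gamma>\<^esub> int (e i)) = \<one>\<^bsub>gamma23 G\<^esub>"
    using g23.gens_pow[of i] f.hom_int_pow[of "x2 i"] assms by simp
  also have "\<dots> = gamma3_class G \<one>"
    using f.hom_one by simp
  finally have "gamma3_class G \<one> = gamma3_class G (x2 i [^] int (e i))"
    using int_pow_Gamma assms by simp
  moreover have "x2 i [^] int (e i) \<in> lower_central G 2"
    using assms by (intro subgroup_int_pow_closed[OF gamma2.subgroup_axioms]) simp
  ultimately show ?thesis
    by (subst (asm) gamma3_class_eq_iff) auto
qed

lemma word_gamma2_dvd:
  assumes "word \<Gamma> x2 idx m = \<one>" "i \<in> {1..4}"
  shows "int (e i) dvd m i"
proof -
  interpret f: group_hom \<Gamma> "gamma23 G" "gamma3_class G"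
    by (rule group_hom_gamma3_class)
  have "word (gamma23 G) (\<lambda>j. gamma3_class G (x2 j)) idx m = \<one>\<^bsub>gamma23 G\<^esub>"
    using f.hom_word[of x2 idx m] x2_list f.hom_one assms(1) by simp
  then show ?thesis
    using g23.word_eq_one_imp_dvd assms(2) by simp
qed

text \<open>
  With \<open>x2 j [^] e j = z [^] f j\<close>, the character sends \<open>x2 j\<close> to \<open>f j / (T e j)\<close>; so \<open>z\<close> is sent
  to \<open>1 / T\<close> and \<open>h\<close> to \<open>1 / 2\<close>.
\<close>

lemma ex_gamma2_character: "\<exists>\<chi>. gamma2_character G \<chi> \<and> \<chi> h \<noteq> 0"
proof -
  have "\<forall>i\<in>{1..4}. \<exists>f::int. x2 i [^] int (e i) = z [^] f"
    using x2_pow_gamma3 gamma3_eq_powers by blast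
  then obtain f' :: "nat \<Rightarrow> int" where f': "\<And>i. i \<in> {1..4} \<Longrightarrow> x2 i [^] int (e i) = z [^] f' i"
    by metis
  \<comment> \<open>The exponent \<open>f' 1\<close> is determined only modulo \<open>T\<close>. The
    fourth power of \<open>x2 1\<close> is \<open>z\<close>, so it may be taken to be 1, which makes
    the value at \<open>h\<close> explicit.\<close>
  define f where "f = f'(1 := 1)"
  have f: "x2 i [^] int (e i) = z [^] f i" if "i \<in> {1..4}" for i
  proof (cases "i = 1")
    case True
    then show ?thesis
      using z_closed int_pow_int[of G "x2 1" 4] by (simp add: f_def e_def z_def)
  next
    case False
    then show ?thesis
      using f' that by (simp add: f_def)
  qed
  define L :: "(nat \<Rightarrow> int) \<Rightarrow> real"
    where "L m = (\<Sum>i\<in>{1..4}. real_of_int (m i) * (real_of_int (f i) / (real T * real (e i))))" for m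
  have L_diff: "L (\<lambda>i. m i - n i) = L m - L n" for m n
    by (simp add: L_def left_diff_distrib diff_divide_distrib sum_subtractf)
  have e_pos: "0 < e i" if "i \<in> {1..4}" for i
    using g23.orders_pos that by simp
  \<comment> \<open>Well-definedness: in a relation each \<open>m i\<close> is a multiple of
    \<open>e i\<close>, so the relation becomes one between powers of \<open>z\<close>, whose total
    exponent is divisible by \<open>T\<close>. Hence \<open>L\<close> modulo integers depends only
    on the element spelled by the word.\<close>
  have L_one: "L m \<in> \<int>" if m: "word \<Gamma> x2 idx m = \<one>" for m
  proof -
    define s where "s i = m i div int (e i)" for i
    have m_eq: "m i = int (e i) * s i" if "i \<in> {1..4}" for i
      using word_gamma2_dvd[OF m that] by (simp add: s_def)
    have pow: "x2 i [^]\<^bsub>\<Gamma>\<^esub> m i = z [^] (f i * s i)" if "i \<in> {1..4}" for i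
    proof -
      have "x2 i [^] m i = (x2 i [^] int (e i)) [^] s i"
        using gamma2_closed that m_eq by (simp add: int_pow_pow)
      then show ?thesis
        using that f z_closed by (simp add: int_pow_Gamma int_pow_pow)
    qed
    have "z [^] (f 1 * s 1 + (f 2 * s 2 + (f 3 * s 3 + f 4 * s 4))) = word \<Gamma> x2 idx m"
      using z_closed pow[of 1] pow[of 2] pow[of 3] pow[of 4] by (simp add: idx_def int_pow_mult)
    then have "int T dvd f 1 * s 1 + (f 2 * s 2 + (f 3 * s 3 + f 4 * s 4))"
      using m int_pow_eq_id[OF z_closed] ord_z by simp
    also have "f 1 * s 1 + (f 2 * s 2 + (f 3 * s 3 + f 4 * s 4)) = (\<Sum>i\<in>set idx. f i * s i)"
      by (subst sum.distinct_set_conv_list) (simp_all add: idx_def)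
    finally obtain t where t: "(\<Sum>i\<in>{1..4}. f i * s i) = int T * t"
      by auto
    have "L m = (\<Sum>i\<in>{1..4}. real_of_int (f i * s i) / real T)"
      unfolding L_def
    proof (intro sum.cong refl)
      fix i :: nat assume i: "i \<in> {1..4}"
      show "real_of_int (m i) * (real_of_int (f i) / (real T * real (e i))) =
            real_of_int (f i * s i) / real T"
        using e_pos[OF i] m_eq[OF i] by (simp add: field_simps)
    qed
    also have "\<dots> = real_of_int (\<Sum>i\<in>{1..4}. f i * s i) / real T"
      by (simp add: sum_divide_distrib)
    also have "\<dots> = real_of_int t"
      unfolding t by (simp add: T_def)
    finally show ?thesis
      by simp
  qed
  define \<chi> where "\<chi> c = circle_of (L (SOME m. word \<Gamma> x2 idx m = c))" for c
  have x2: "x2 ` set idx \<subseteq> carrier \<Gamma>"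
    using x2_list by simp
  have chi: "\<chi> (word \<Gamma> x2 idx m) = circle_of (L m)" for m
  proof -
    define n where "n = (SOME n. word \<Gamma> x2 idx n = word \<Gamma> x2 idx m)"
    have n: "word \<Gamma> x2 idx n = word \<Gamma> x2 idx m"
      unfolding n_def by (rule someI[where x = m]) (rule refl)
    have "word \<Gamma> x2 idx (\<lambda>i. m i + (n i - m i)) = word \<Gamma> x2 idx m \<otimes>\<^bsub>\<Gamma>\<^esub> word \<Gamma> x2 idx (\<lambda>i. n i - m i)"
      by (rule G2.word_add[OF x2])
    then have "word \<Gamma> x2 idx (\<lambda>i. n i - m i) = \<one>\<^bsub>\<Gamma>\<^esub>"
      using n G2.l_cancel_one'[OF G2.word_closed[OF x2] G2.word_closed[OF x2]] by simp
    then have "L n - L m \<in> \<int>"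
      using L_one[of "\<lambda>i. n i - m i"] by (simp add: L_diff)
    then show ?thesis
      by (simp add: \<chi>_def n_def[symmetric] circle_of_eq_0_iff[symmetric] circle_of_diff)
  qed
  have "gamma2_character G \<chi>"
  proof
    fix c c' assume "c \<in> lower_central G 2" "c' \<in> lower_central G 2"
    then obtain m m' where m: "c = word \<Gamma> x2 idx m" "c' = word \<Gamma> x2 idx m'"
      using ex_word_gamma2 by metis
    have "c \<otimes> c' = word \<Gamma> x2 idx (\<lambda>i. m i + m' i)"
      using G2.word_add[OF x2, of m m'] m by simp
    moreover have "L (\<lambda>i. m i + m' i) = L m + L m'"
      by (simp add: L_def distrib_right add_divide_distrib sum.distrib)
    ultimately show "\<chi> (c \<otimes> c') = \<chi> c + \<chi> c'"
      unfolding m by (simp add: chi circle_of_add)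
  qed
  moreover have "\<chi> h \<noteq> 0"
  proof -
    let ?m = "\<lambda>j. if j = 1 then 2 ^ (k + 5) else 0"
    have "h = x2 1 [^] (2 ^ (k + 5) :: int)"
      using gamma2_closed[OF x2_in_gamma2[of 1]]
        int_pow_pow[of "x2 1" 4 "2 ^ (k + 3)"] int_pow_int[of G "x2 1" 4]
      by (simp add: h_eq_z z_def power_add mult.commute)
    also have "\<dots> = word \<Gamma> x2 idx ?m"
      using int_pow_Gamma[of "x2 1"] by (simp add: idx_def)
    finally have "\<chi> h = circle_of (L ?m)"
      using chi by simp
    also have "L ?m = (\<Sum>i\<in>{1..4 :: nat}. if i = 1 then 1 / 2 else 0)"
      unfolding L_def by (intro sum.cong) (auto simp: f_def e_def T_def power_add)
    also have "\<dots> = 1 / 2"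
      by simp
    finally have "\<chi> h = circle_of (1 / 2)" .
    moreover have "(1 / 2 :: real) \<notin> \<int>"
    proof
      assume "(1 / 2 :: real) \<in> \<int>"
      then obtain n where "1 / 2 = real_of_int n"
        by (elim Ints_cases)
      then have "real_of_int (2 * n) = real_of_int 1"
        by simp
      then have "2 * n = 1"
        by (simp only: of_int_eq_iff)
      then show False
        by presburger
    qed
    ultimately show ?thesis
      by (simp add: circle_of_eq_0_iff)
  qed
  ultimately show ?thesis
    by blast
qed

text \<open>\<open>?K\<close> consists of the even powers of \<open>z\<close>, a proper subgroup of
  \<open>\<gamma>\<^sub>3\<close> since \<open>T\<close> is even. Some triple commutator avoids it
  and is an odd power of \<open>z\<close>; raising it to half of \<open>T\<close> gives
  \<open>h\<close>, and \<open>triple_commutator_pow\<close> moves the exponent inside.\<close>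

lemma ex_triple_commutator:
  obtains a b c where "a \<in> carrier G" "b \<in> carrier G" "c \<in> carrier G"
    "h = commutator G (commutator G a b) c"
proof -
  let ?K = "range (\<lambda>s::int. z [^] (2 * s))"
  have K: "subgroup ?K G"
  proof (rule subgroupI)
    fix a b assume "a \<in> ?K" "b \<in> ?K"
    then obtain s t :: int where "a = z [^] (2 * s)" "b = z [^] (2 * t)"
      by auto
    then have "a \<otimes> b = z [^] (2 * (s + t))"
      using z_closed by (simp add: int_pow_mult distrib_left)
    then show "a \<otimes> b \<in> ?K"
      by blast
  next
    fix a assume "a \<in> ?K"
    then obtain s :: int where "a = z [^] (2 * s)"
      by auto
    then have "inv a = z [^] (2 * - s)"
      using z_closed int_pow_neg[of z "2 * s"] by simp
    then show "inv a \<in> ?K"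
      by blast
  qed (use z_closed in auto)
  have "z \<notin> ?K"
  proof
    assume "z \<in> ?K"
    then obtain s :: int where "z [^] (1 :: int) = z [^] (2 * s)"
      using z_closed by auto
    then have "int T dvd 2 * s - 1"
      using int_pow_eq[OF z_closed] ord_z by simp
    then have "(2 :: int) dvd 2 * s - 1"
      by (rule dvd_trans[rotated]) (simp add: T_def)
    then show False
      by presburger
  qed
  moreover have "z \<in> lower_central G 3"
    using gamma3_eq_powers z_closed by (metis int_pow_1)
  ultimately have "\<not> lower_central G 3 \<subseteq> ?K"
    by blast
  then have "\<not> {commutator G x y | x y. x \<in> lower_central G 2 \<and> y \<in> carrier G} \<subseteq> ?K"
    using generate_subgroup_incl[OF _ K] unfolding gamma3_eq by blast
  then obtain g y where gy: "g \<in> lower_central G 2" "y \<in> carrier G" "commutator G g y \<notin> ?K"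
    by blast
  \<comment> \<open>With \<open>y\<close> fixed, the commutator is multiplicative on
    \<open>\<gamma>\<^sub>2\<close>, so \<open>?C\<close> is a subgroup. It misses \<open>g\<close>,
    hence it also misses one of the commutators generating \<open>\<gamma>\<^sub>2\<close>, and
    \<open>g\<close> can be replaced by a commutator of two elements.\<close>
  let ?C = "{c \<in> lower_central G 2. commutator G c y \<in> ?K}"
  have C: "subgroup ?C G"
  proof (rule subgroupI)
    fix a b assume "a \<in> ?C" "b \<in> ?C"
    then show "a \<otimes> b \<in> ?C"
      using gy(2) subgroup.m_closed[OF K] by (simp add: commutator_mult_gamma2)
  next
    fix a assume a: "a \<in> ?C"
    then have "commutator G (inv a) y \<otimes> commutator G a y = \<one>"
      using gy(2) commutator_mult_gamma2[of "inv a" a y] by (simp add: commutator_def)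
    moreover have "commutator G a y \<in> carrier G" "commutator G (inv a) y \<in> carrier G"
      using a gy(2) by (auto simp: commutator_def)
    ultimately have "commutator G (inv a) y = inv (commutator G a y)"
      by (metis inv_equality)
    then show "inv a \<in> ?C"
      using a subgroup.m_inv_closed[OF K] by auto
  next
    have "\<one> \<in> ?C"
      using gy(2) subgroup.one_closed[OF K] by (simp add: commutator_def)
    then show "?C \<noteq> {}"
      by blast
  qed auto
  have "\<not> lower_central G 2 \<subseteq> ?C"
    using gy by blast
  then have "\<not> {commutator G a b | a b. a \<in> carrier G \<and> b \<in> carrier G} \<subseteq> ?C"
    using generate_subgroup_incl[OF _ C] unfolding gamma2_eq by blast
  then obtain a b where ab: "a \<in> carrier G" "b \<in> carrier G" "commutator G a b \<notin> ?C"
    by blast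
  let ?w = "commutator G (commutator G a b) y"
  have w: "?w \<in> lower_central G 3" "?w \<notin> ?K"
    using ab gy(2) commutator_in_gamma2 commutator_in_gamma3 by auto
  then obtain s :: int where s: "?w = z [^] s"
    using gamma3_eq_powers by blast
  have "odd s"
    using w(2) s by auto
  then obtain t where t: "s = 2 * t + 1"
    by (rule oddE)
  have "?w [^] ((2::nat) ^ (k + 3)) = z [^] (s * int (2 ^ (k + 3)))"
    using z_closed by (simp add: s int_pow_pow flip: int_pow_int)
  also have "s * int (2 ^ (k + 3)) = int T * t + int (2 ^ (k + 3))"
    by (simp add: t T_def power_add algebra_simps)
  also have "z [^] \<dots> = h"
    using z_closed by (simp only: int_pow_mult z_pow_T h_eq_z l_one int_pow_closed)
  finally have "h = commutator G (commutator G (a [^] ((2::nat) ^ (k + 3))) b) y"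
    using triple_commutator_pow[OF ab(1,2) gy(2)] by simp
  then show ?thesis
    using that ab gy(2) nat_pow_closed by blast
qed

end


section \<open>The cubic function\<close>

context tahara_group
begin

text \<open>\<open>n\<close> is an integer lift of the coordinates of \<open>g\<close> in the
  abelianization; its entries are unique only modulo \<open>d i\<close>.\<close>

definition represents :: "(nat \<Rightarrow> int) \<Rightarrow> 'a \<Rightarrow> bool" where
  "represents n g \<longleftrightarrow> g \<in> carrier G \<and> ab_class G (word G x1 idx n) = ab_class G g"

lemma represents_mult:
  assumes "represents m g" "represents n g'"
  shows "represents (\<lambda>i. m i + n i) (g \<otimes> g')"
proof -
  interpret f: group_hom G "abelianization G" "ab_class G"
    by (rule group_hom_ab_class)
  show ?thesis
    using assms x1_list by (simp add: represents_def ab_class_word_add)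
qed

lemma represents_one: "represents (\<lambda>i. 0) \<one>"
  by (simp add: represents_def word_zero)

lemma represents_inv:
  assumes "represents n g"
  shows "represents (\<lambda>i. - n i) (inv g)"
proof -
  interpret f: group_hom G "abelianization G" "ab_class G"
    by (rule group_hom_ab_class)
  have "ab_class G (word G x1 idx (\<lambda>i. - n i + n i)) =
        ab_class G (word G x1 idx (\<lambda>i. - n i)) \<otimes>\<^bsub>abelianization G\<^esub> ab_class G (word G x1 idx n)"
    using x1_list by (simp only: ab_class_word_add f.hom_mult word_closed)
  then have "ab_class G (word G x1 idx (\<lambda>i. - n i)) \<otimes>\<^bsub>abelianization G\<^esub> ab_class G g =
        \<one>\<^bsub>abelianization G\<^esub>"
    using assms by (simp add: represents_def word_zero)
  then have "ab_class G (word G x1 idx (\<lambda>i. - n i)) = inv\<^bsub>abelianization G\<^esub> ab_class G g"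
    using assms x1_list ab.inv_equality by (simp add: represents_def)
  then show ?thesis
    using assms by (simp add: represents_def)
qed

lemma ex_represents:
  assumes "g \<in> carrier G"
  obtains n where "represents n g"
  using ex_ab_class_word[OF assms] assms by (auto simp: represents_def)

lemma represents_dvd:
  assumes "represents m g" "represents n g" "i \<in> {1..4}"
  shows "int (d i) dvd n i - m i"
  using assms ab_class_word_eq_imp_dvd by (simp add: represents_def)

lemma represents_gamma2:
  assumes "c \<in> lower_central G 2"
  shows "represents (\<lambda>i. 0) c"
  using assms ab_class_eq_iff[of \<one> c] gamma2_closed by (simp add: represents_def word_zero)

lemma h_gamma2: "h \<in> lower_central G 2"
  unfolding h_eq_z using gamma3_eq_powers gamma3_subset_gamma2 by blast

lemma idx_split:
  assumes "i \<in> {1..4}"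
  obtains ps qs where "idx = ps @ i # qs" "set qs = {i<..4}"
proof -
  have "idx = [] @ 1 # [2, 3, 4]" "idx = [1] @ 2 # [3, 4]" "idx = [1, 2] @ 3 # [4]"
    "idx = [1, 2, 3] @ 4 # []"
    by (simp_all add: idx_def)
  moreover have "set [2, 3, 4] = {1<..4 :: nat}" "set [3, 4] = {2<..4 :: nat}"
    "set [4] = {3<..4 :: nat}" "set [] = {4<..4 :: nat}"
    by auto
  ultimately show ?thesis
    using assms that unfolding in_1_4_iff by metis
qed

lemma represents_shift:
  assumes "represents n g" and i: "i \<in> {1..4}"
  shows "represents (n(i := n i + s * int (d i))) g"
proof -
  let ?e = "\<lambda>j. if j = i then s * int (d i) else 0"
  obtain ps qs where idx: "idx = ps @ i # qs"
    using idx_split[OF i] by blast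
  have "i \<notin> set ps" "i \<notin> set qs"
    using distinct_idx unfolding idx by auto
  then have "word G x1 ps ?e = \<one>" "word G x1 qs ?e = \<one>"
    by (auto intro!: word_zero)
  moreover have "x1 ` set (ps @ i # qs) \<subseteq> carrier G"
    using x1_list unfolding idx .
  ultimately have "word G x1 idx ?e = x1 i [^] (s * int (d i))"
    using i unfolding idx by (subst word_append) simp_all
  also have "\<dots> = (x1 i [^] int (d i)) [^] s"
    using i by (simp add: int_pow_pow mult.commute)
  also have "\<dots> \<in> lower_central G 2"
    by (rule subgroup_int_pow_closed[OF gamma2.subgroup_axioms x1_pow_gamma2[OF i]])
  finally have "ab_class G \<one> = ab_class G (word G x1 idx ?e)"
    using ab_class_eq_iff[of \<one> "word G x1 idx ?e"] x1_list by simp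
  then have "represents ?e \<one>"
    by (simp add: represents_def)
  from represents_mult[OF assms(1) this] have "represents (\<lambda>j. n j + ?e j) g"
    using assms(1) by (simp add: represents_def)
  moreover have "(\<lambda>j. n j + ?e j) = n(i := n i + s * int (d i))"
    by auto
  ultimately show ?thesis
    by simp
qed

text \<open>Consequently the residues modulo 4 of representing exponents depend only on the element
  represented.\<close>

lemma four_dvd_d:
  assumes "i \<in> {1..4}"
  shows "4 dvd d i"
proof -
  have "(2::nat) ^ 2 dvd 2 ^ k"
    using k_ge_2 by (rule le_imp_power_dvd)
  then show ?thesis
    using assms unfolding in_1_4_iff by (auto simp: d_def power_add)
qed

lemma d_pos: "i \<in> {1..4} \<Longrightarrow> 0 < d i"
  using ab.orders_pos by simp

end

text \<open>
  The quadratic correction uses \<open>n l - v l\<close> instead of \<open>n l\<close>. Replacing \<open>n j\<close> by \<open>n j + d j\<close> changes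
  the term \<open>(n l * n j) \<odot> \<psi> l j\<close> by \<open>(n l * d j) \<odot> \<psi> l j\<close>, where \<open>d j \<odot> \<psi> l j\<close> is the value of
  the character at the pair value; this has order dividing 4, so the defect disappears if \<open>v\<close> agrees
  with \<open>n\<close> modulo 4.
\<close>

locale tahara_character = tahara_group G k x1 x2 z T + gamma2_character G \<chi>
  for G :: "('a, 'b) monoid_scheme" (structure) and k x1 x2 z T and \<chi> :: "'a \<Rightarrow> circle" +
  fixes \<phi> :: "nat \<Rightarrow> circle" and \<psi> :: "nat \<Rightarrow> nat \<Rightarrow> circle"
  assumes phi: "i \<in> {1..4} \<Longrightarrow> int (d i) \<odot>\<^sub>z \<phi> i = \<chi> (x1 i [^] int (d i))"
    and psi: "i \<in> {1..4} \<Longrightarrow> j \<in> {1..4} \<Longrightarrow> i < j \<Longrightarrow>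
                int (d i) \<odot>\<^sub>z \<psi> i j = \<chi> (commutator G (x1 i [^] int (d i)) (x1 j))"
begin

text \<open>\<open>\<psi> i j\<close> is a \<open>d i\<close>-th root of a value annihilated by 4
  times the quotient of \<open>d j\<close> by \<open>d i\<close>; the product of the two factors is
  4 times \<open>d j\<close>.\<close>

lemma psi_order:
  assumes "i \<in> {1..4}" "j \<in> {1..4}" "i < j" "4 * int (d j) dvd t"
  shows "t \<odot>\<^sub>z \<psi> i j = 0"
proof -
  have "(int (4 * (d j div d i)) * int (d i)) \<odot>\<^sub>z \<psi> i j = 0"
    using chi_pair_value[OF gamma2_character_axioms assms(1-3)]
    by (simp only: zmul_zmul[symmetric] psi[OF assms(1-3)])
  moreover have "4 * (d j div d i) * d i = 4 * d j"
    using d_dvd_d[OF assms(1-3)] by (simp add: mult.assoc)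
  then have "int (4 * (d j div d i)) * int (d i) = 4 * int (d j)"
    by (metis of_nat_mult of_nat_numeral)
  ultimately have "(4 * int (d j)) \<odot>\<^sub>z \<psi> i j = 0"
    by (simp only:)
  then show ?thesis
    using zmul_eq_0_dvd assms(4) by blast
qed

text \<open>Under a shift of one exponent, the linear sum cancels the character value in
  \<open>chi_word_shift\<close> and the double sum cancels the twists, which involve only later
  letters; hence \<open>l < j\<close>.\<close>

definition cubic :: "'a \<Rightarrow> (nat \<Rightarrow> int) \<Rightarrow> (nat \<Rightarrow> int) \<Rightarrow> circle" where
  "cubic g n v = \<chi> (inv (word G x1 idx n) \<otimes> g) + (\<Sum>l\<in>{1..4}. n l \<odot>\<^sub>z \<phi> l) +
     (\<Sum>l\<in>{1..4}. \<Sum>j\<in>{l<..4}. ((n l - v l) * n j) \<odot>\<^sub>z \<psi> l j)"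

lemma cubic_shift:
  assumes i: "i \<in> {1..4}" and n: "represents n g" and v: "\<And>l. l \<in> {1..4} \<Longrightarrow> 4 dvd n l - v l"
  shows "cubic g (n(i := n i + s * int (d i))) v = cubic g n v"
proof -
  let ?n = "n(i := n i + s * int (d i))"
  let ?t = "\<Sum>j\<in>{i<..4}. (s * n j) \<odot>\<^sub>z twist (x1 i [^] int (d i)) (x1 j)"
  obtain ps qs where idx: "idx = ps @ i # qs" "set qs = {i<..4}"
    using idx_split[OF i] .
  have "\<chi> (inv (word G x1 idx ?n) \<otimes> g) =
        \<chi> (inv (word G x1 idx n) \<otimes> g) - s \<odot>\<^sub>z \<chi> (x1 i [^] int (d i)) - ?t"
    using chi_word_shift[OF x1_list distinct_idx idx(1) x1_pow_gamma2[OF i], of g n s] n idx(2)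
    by (simp add: represents_def)
  moreover have "(\<Sum>l\<in>{1..4}. ?n l \<odot>\<^sub>z \<phi> l) = (\<Sum>l\<in>{1..4}. n l \<odot>\<^sub>z \<phi> l) + s \<odot>\<^sub>z \<chi> (x1 i [^] int (d i))"
  proof -
    have "(\<Sum>l\<in>{1..4}. ?n l \<odot>\<^sub>z \<phi> l) =
          (\<Sum>l\<in>{1..4}. n l \<odot>\<^sub>z \<phi> l + (if l = i then s \<odot>\<^sub>z \<chi> (x1 i [^] int (d i)) else 0))"
      using phi[OF i] by (intro sum.cong) (auto simp: zmul_add_left simp flip: zmul_zmul)
    then show ?thesis
      using i by (simp add: sum.distrib)
  qed
  moreover have "(\<Sum>l\<in>{1..4}. \<Sum>j\<in>{l<..4}. ((?n l - v l) * ?n j) \<odot>\<^sub>z \<psi> l j) =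
      (\<Sum>l\<in>{1..4}. \<Sum>j\<in>{l<..4}. ((n l - v l) * n j) \<odot>\<^sub>z \<psi> l j) + ?t"
  proof -
    have *: "((?n l - v l) * ?n j) \<odot>\<^sub>z \<psi> l j = ((n l - v l) * n j) \<odot>\<^sub>z \<psi> l j +
            (if l = i then (s * n j) \<odot>\<^sub>z twist (x1 i [^] int (d i)) (x1 j) else 0)"
      if l: "l \<in> {1..4}" and j: "j \<in> {l<..4}" for l j
    proof -
      have lj: "j \<in> {1..4}" "l < j"
        using l j by auto
      \<comment> \<open>For \<open>l = i\<close> the change of the summand is exactly the twist
        term. For \<open>j = i\<close> it is a multiple of \<open>4 * int (d j)\<close>, as
        \<open>v\<close> agrees with \<open>n\<close> modulo 4, and \<open>psi_order\<close>
        annihilates it.\<close>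
      consider "l = i" | "l \<noteq> i" "j = i" | "l \<noteq> i" "j \<noteq> i"
        by blast
      then show ?thesis
      proof cases
        case 1
        have "twist (x1 i [^] int (d i)) (x1 j) = int (d i) \<odot>\<^sub>z \<psi> i j"
          using psi[of i j] i lj 1 twist_eq_chi_commutator[OF x1_pow_gamma2[OF i]] by simp
        moreover have "(?n l - v l) * ?n j = (n l - v l) * n j + s * n j * int (d i)"
          using 1 lj by (simp add: algebra_simps)
        ultimately show ?thesis
          using 1 by (simp only: zmul_add_left zmul_zmul simp_thms if_True)
      next
        case 2
        have "(?n l - v l) * ?n j = (n l - v l) * n j + (n l - v l) * (s * int (d j))"
          using 2 by (simp add: algebra_simps)
        moreover have "((n l - v l) * (s * int (d j))) \<odot>\<^sub>z \<psi> l j = 0"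
          using v[OF l] by (intro psi_order l lj mult_dvd_mono) auto
        ultimately show ?thesis
          using 2 by (simp only: zmul_add_left if_False)
      next
        case 3
        then show ?thesis
          by simp
      qed
    qed
    have "(\<Sum>l\<in>{1..4}. \<Sum>j\<in>{l<..4}. ((?n l - v l) * ?n j) \<odot>\<^sub>z \<psi> l j) =
        (\<Sum>l\<in>{1..4}. (\<Sum>j\<in>{l<..4}. ((n l - v l) * n j) \<odot>\<^sub>z \<psi> l j) + (if l = i then ?t else 0))"
    proof (intro sum.cong refl)
      fix l :: nat assume l: "l \<in> {1..4}"
      have "(\<Sum>j\<in>{l<..4}. ((?n l - v l) * ?n j) \<odot>\<^sub>z \<psi> l j) =
          (\<Sum>j\<in>{l<..4}. ((n l - v l) * n j) \<odot>\<^sub>z \<psi> l j +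
            (if l = i then (s * n j) \<odot>\<^sub>z twist (x1 i [^] int (d i)) (x1 j) else 0))"
        using *[OF l] by (intro sum.cong refl) blast
      then show "(\<Sum>j\<in>{l<..4}. ((?n l - v l) * ?n j) \<odot>\<^sub>z \<psi> l j) =
          (\<Sum>j\<in>{l<..4}. ((n l - v l) * n j) \<odot>\<^sub>z \<psi> l j) + (if l = i then ?t else 0)"
        by (simp only: sum.distrib) (simp del: fun_upd_apply)
    qed
    then show ?thesis
      using i by (simp only: sum.distrib sum.delta finite_atLeastAtMost if_True)
  qed
  moreover have "(a - x - y) + (b + x) + (c + y) = a + b + c" for a b c x y :: circle
    by (simp add: algebra_simps)
  ultimately show ?thesis
    unfolding cubic_def by (simp only:)
qed

text \<open>Two representing vectors differ by multiples of the \<open>d i\<close>, so one turns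
  into the other by four shifts. The intermediate vector \<open>?m i\<close> has its first
  \<open>i\<close> entries from \<open>m\<close>; as 4 divides each \<open>d i\<close>, it stays
  congruent to \<open>v\<close> modulo 4.\<close>

lemma cubic_cong_n:
  assumes n: "represents n g" and m: "represents m g" and v: "\<And>l. l \<in> {1..4} \<Longrightarrow> 4 dvd n l - v l"
  shows "cubic g n v = cubic g m v"
proof -
  let ?m = "\<lambda>i l. if l \<in> {1..i} then m l else n l"
  have "i \<le> 4 \<Longrightarrow> cubic g (?m i) v = cubic g n v \<and> represents (?m i) g \<and>
          (\<forall>l\<in>{1..4}. 4 dvd ?m i l - v l)" for i
  proof (induction i)
    case 0
    then show ?case
      using n v by simp
  next
    case (Suc i)
    then have Suc_i: "Suc i \<in> {1..4}"
      by auto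
    obtain s where "m (Suc i) - n (Suc i) = int (d (Suc i)) * s"
      using represents_dvd[OF n m Suc_i] by (rule dvdE)
    then have s: "m (Suc i) = n (Suc i) + s * int (d (Suc i))"
      by (simp add: algebra_simps)
    have eq: "?m (Suc i) = (?m i)(Suc i := ?m i (Suc i) + s * int (d (Suc i)))"
      using s by (auto simp: fun_eq_iff le_Suc_eq)
    have IH: "cubic g (?m i) v = cubic g n v" "represents (?m i) g"
      "\<And>l. l \<in> {1..4} \<Longrightarrow> 4 dvd ?m i l - v l"
      using Suc by auto
    have "4 dvd ?m (Suc i) l - v l" if "l \<in> {1..4}" for l
    proof (cases "l = Suc i")
      case True
      have "int 4 dvd int (d (Suc i))"
        using four_dvd_d[OF Suc_i] by (simp only: of_nat_dvd_iff)
      then have "4 dvd s * int (d (Suc i))"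
        by (intro dvd_mult) simp
      then have "4 dvd (n (Suc i) - v (Suc i)) + s * int (d (Suc i))"
        using v[OF Suc_i] by (rule dvd_add[rotated])
      then show ?thesis
        using True s by (simp add: algebra_simps)
    next
      case False
      then show ?thesis
        using IH(3)[OF that] by (auto simp: le_Suc_eq split: if_splits)
    qed
    moreover have "cubic g (?m (Suc i)) v = cubic g n v"
      unfolding eq using cubic_shift[OF Suc_i IH(2,3)] IH(1) by simp
    moreover have "represents (?m (Suc i)) g"
      unfolding eq by (rule represents_shift[OF IH(2) Suc_i])
    ultimately show ?case
      by blast
  qed
  from this[of 4] have "cubic g (?m 4) v = cubic g n v"
    by simp
  moreover have "word G x1 idx (?m 4) = word G x1 idx m"
    by (rule word_cong) simp
  then have "cubic g (?m 4) v = cubic g m v"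
    by (simp add: cubic_def)
  ultimately show ?thesis
    by simp
qed

text \<open>The auxiliary vector matters only modulo \<open>4 * int (d j)\<close>. So coordinates in
  a cyclic sum whose orders are divisible by these numbers can serve as \<open>v\<close>.\<close>

lemma cubic_cong_v:
  assumes "\<And>l j. l \<in> {1..4} \<Longrightarrow> j \<in> {1..4} \<Longrightarrow> 4 * int (d j) dvd v l - w l"
  shows "cubic g n v = cubic g n w"
proof -
  have "((n l - v l) * n j) \<odot>\<^sub>z \<psi> l j = ((n l - w l) * n j) \<odot>\<^sub>z \<psi> l j"
    if "l \<in> {1..4}" "j \<in> {l<..4}" for l j
  proof -
    have lj: "j \<in> {1..4}" "l < j"
      using that by auto
    have "((v l - w l) * n j) \<odot>\<^sub>z \<psi> l j = 0"
      using assms[OF that(1) lj(1)] by (intro psi_order that lj) auto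
    moreover have "(n l - w l) * n j = (n l - v l) * n j + (v l - w l) * n j"
      by (simp add: algebra_simps)
    ultimately show ?thesis
      by (simp only: zmul_add_left add_0_right)
  qed
  then show ?thesis
    unfolding cubic_def by simp
qed

text \<open>The correction has degree two because \<open>v\<close>, like \<open>n\<close>, is
  additive: it is then the diagonal of a biadditive map. This is why \<open>v\<close> has to be a
  homomorphism and not just a choice of residues modulo 4.\<close>

lemma poly_lt_cubic:
  assumes "monoid H" and p: "p \<in> hom H G" and n: "n \<in> hom H int_vectors" and v: "v \<in> hom H int_vectors"
    and rep: "\<And>u. u \<in> carrier H \<Longrightarrow> represents (n u) (p u)"
  shows "poly_lt H 4 (\<lambda>u. cubic (p u) (n u) (v u))"
proof -
  interpret H: monoid H
    by fact
  have n_add: "n (u \<otimes>\<^bsub>H\<^esub> w) i = n u i + n w i" and v_add: "v (u \<otimes>\<^bsub>H\<^esub> w) i = v u i + v w i"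
    if "u \<in> carrier H" "w \<in> carrier H" for u w i
    using hom_mult[OF n that] hom_mult[OF v that] by simp_all
  have "poly_lt H 4 (\<lambda>u. \<chi> (inv (word G x1 idx (n u)) \<otimes> p u))"
    using rep by (intro poly_lt_chi_word assms x1_list) (auto simp: represents_def)
  moreover have "poly_lt H 4 (\<lambda>u. n u l \<odot>\<^sub>z \<phi> l)" for l
    by (rule H.poly_lt_mono[of 2], simp, rule H.poly_lt_additive) (simp add: n_add zmul_add_left)
  moreover have "poly_lt H 4 (\<lambda>u. ((n u l - v u l) * n u j) \<odot>\<^sub>z \<psi> l j)" for l j
    by (rule H.poly_lt_mono[of 3], simp,
        rule H.poly_lt_biadditive[where B = "\<lambda>u w. ((n u l - v u l) * n w j) \<odot>\<^sub>z \<psi> l j"])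
      (simp_all add: n_add v_add algebra_simps flip: zmul_add_left)
  ultimately show ?thesis
    unfolding cubic_def by (intro H.poly_lt_add H.poly_lt_sum) auto
qed

end

lemma (in tahara_group) ex_tahara_character:
  obtains \<chi> \<phi> \<psi> where "tahara_character G k x1 x2 \<chi> \<phi> \<psi>" "\<chi> h \<noteq> 0"
proof -
  obtain \<chi> where \<chi>: "gamma2_character G \<chi>" "\<chi> h \<noteq> 0"
    using ex_gamma2_character by blast
  have divide: "\<exists>s. int (d i) \<odot>\<^sub>z s = t" if "i \<in> {1..4}" for i t
    using zmul_divisible[of "int (d i)" t] d_pos[OF that] by auto
  then have "\<exists>s. \<forall>i\<in>{1..4}. \<forall>t. int (d i) \<odot>\<^sub>z s i t = t"
    by (intro exI[of _ "\<lambda>i t. SOME s. int (d i) \<odot>\<^sub>z s = t"]) (auto intro: someI_ex)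
  then obtain s where s: "\<And>i t. i \<in> {1..4} \<Longrightarrow> int (d i) \<odot>\<^sub>z s i t = t"
    by blast
  have "tahara_character G k x1 x2 \<chi> (\<lambda>i. s i (\<chi> (x1 i [^] int (d i))))
          (\<lambda>i j. s i (\<chi> (commutator G (x1 i [^] int (d i)) (x1 j))))"
    using \<chi>(1) tahara_group_axioms
    by (intro tahara_character.intro tahara_character_axioms.intro s)
  then show ?thesis
    using that \<chi>(2) by blast
qed


section \<open>The weight filtration\<close>

context group
begin

lemma lower_central_closed: "lower_central G s \<subseteq> carrier G"
proof (induction s)
  case (Suc s)
  show ?case
  proof (cases s)
    case (Suc r)
    have "{commutator G x y | x y. x \<in> lower_central G (Suc r) \<and> y \<in> carrier G} \<subseteq> carrier G"
      using Suc.IH unfolding Suc by (auto simp: commutator_def)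
    then show ?thesis
      unfolding Suc lower_central.simps by (rule generate_incl)
  qed simp
qed simp

lemma weighted_product_closed:
  assumes "\<forall>(a, x)\<in>set ps. a \<ge> 1 \<and> x \<in> lower_central G a"
  shows "weighted_product G ps \<in> carrier (group_ring G)"
  using assms
proof (induction ps)
  case Nil
  then show ?case
    by (simp add: weighted_product_def keys_frag_of)
next
  case (Cons p ps)
  obtain a x where p: "p = (a, x)"
    by (cases p)
  have "minus_one G x \<otimes>\<^bsub>group_ring G\<^esub> weighted_product G ps \<in> carrier (group_ring G)"
    using Cons lower_central_closed[of a] p
    by (intro group_ring_mult_closed minus_one_in_carrier) auto
  then show ?case
    by (simp add: weighted_product_def p del: group_ring_simps)
qed

lemma weight_filtration_subgroup:
  "subgroup (weight_filtration m G (lower_central G)) (add_monoid (group_ring G))"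
proof -
  interpret R: ring "group_ring G"
    by (rule group_ring_is_ring)
  show ?thesis
    unfolding weight_filtration_def
    using weighted_product_closed by (intro R.add.generate_is_subgroup) (auto simp del: group_ring_simps)
qed

lemma weight_filtration_closed:
  assumes "f \<in> weight_filtration m G (lower_central G)"
  shows "f \<in> carrier (group_ring G)"
  using subgroup.mem_carrier[OF weight_filtration_subgroup assms] by simp

lemma weight_filtration_uminus:
  assumes "f \<in> weight_filtration m G (lower_central G)"
  shows "- f \<in> weight_filtration m G (lower_central G)"
  using subgroup.m_inv_closed[OF weight_filtration_subgroup assms]
    group_ring_uminus[OF weight_filtration_closed[OF assms]]
  by (simp add: a_inv_def)

lemma weight_filtration_add:
  assumes "f \<in> weight_filtration m G (lower_central G)" "g \<in> weight_filtration m G (lower_central G)"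
  shows "f + g \<in> weight_filtration m G (lower_central G)"
  using subgroup.m_closed[OF weight_filtration_subgroup assms] by simp

lemma weight_filtration_0: "0 \<in> weight_filtration m G (lower_central G)"
  using subgroup.one_closed[OF weight_filtration_subgroup] by simp

lemma weight_filtration_weighted_product:
  assumes "\<forall>(a, x)\<in>set ps. a \<ge> 1 \<and> x \<in> lower_central G a" "sum_list (map fst ps) \<ge> m"
  shows "weighted_product G ps \<in> weight_filtration m G (lower_central G)"
  unfolding weight_filtration_def using assms by (intro generate.incl) blast

lemma minus_one_mult_weight_filtration:
  assumes x: "x \<in> carrier G" and f: "f \<in> weight_filtration m G (lower_central G)"
  shows "minus_one G x \<otimes>\<^bsub>group_ring G\<^esub> f \<in> weight_filtration (Suc m) G (lower_central G)"
proof -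
  have *: "minus_one G x \<otimes>\<^bsub>group_ring G\<^esub> f \<in> weight_filtration (Suc m) G (lower_central G)"
    if f: "f \<in> {weighted_product G ps | ps. (\<forall>(a, x)\<in>set ps. a \<ge> 1 \<and> x \<in> lower_central G a) \<and>
        sum_list (map fst ps) \<ge> m}" for f
  proof -
    obtain ps where ps: "f = weighted_product G ps"
      "\<forall>(a, x)\<in>set ps. a \<ge> 1 \<and> x \<in> lower_central G a" "sum_list (map fst ps) \<ge> m"
      using f by blast
    have "weighted_product G ((1, x) # ps) \<in> weight_filtration (Suc m) G (lower_central G)"
      using ps x by (intro weight_filtration_weighted_product) auto
    then show ?thesis
      by (simp add: ps(1) weighted_product_def del: group_ring_simps)
  qed
  from f show ?thesis
    unfolding weight_filtration_def[of m]
  proof (induction f)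
    case one
    then show ?case
      by (simp add: weight_filtration_0)
  next
    case (incl f)
    then show ?case
      by (rule *)
  next
    case (inv f)
    have f: "f \<in> weight_filtration m G (lower_central G)"
      using inv unfolding weight_filtration_def by (rule generate.incl)
    have "inv\<^bsub>add_monoid (group_ring G)\<^esub> f = - f"
      using group_ring_uminus[OF weight_filtration_closed[OF f]] by (simp add: a_inv_def)
    moreover have "minus_one G x \<otimes>\<^bsub>group_ring G\<^esub> (- f) = - (minus_one G x \<otimes>\<^bsub>group_ring G\<^esub> f)"
      using frag_extend_fun_diff[of "\<lambda>x. 0" "\<lambda>x. frag_extend (\<lambda>y. frag_of (x \<otimes> y)) f" "minus_one G x"]
      by (simp add: frag_extend_minus)
    ultimately show ?case
      using weight_filtration_uminus[OF *[OF inv]] by (simp only:)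
  next
    case (eng f g)
    have "minus_one G x \<otimes>\<^bsub>group_ring G\<^esub> (f + g) =
          minus_one G x \<otimes>\<^bsub>group_ring G\<^esub> f + minus_one G x \<otimes>\<^bsub>group_ring G\<^esub> g"
      by (simp add: frag_extend_add frag_extend_fun_add)
    then show ?case
      using weight_filtration_add[OF eng.IH] by simp
  qed
qed

text \<open>Give every factor x - 1 the weight 1, the first lower central term being the whole
  group.\<close>

lemma augmentation_power_weight_filtration:
  "f \<in> augmentation_power G m \<Longrightarrow> f \<in> weight_filtration m G (lower_central G)"
proof (induction rule: augmentation_power_induct)
  case (diff m f g)
  then show ?case
    using weight_filtration_add[OF _ weight_filtration_uminus] by fastforce
next
  case (of x)
  \<comment> \<open>A group element is (x - 1) + 1, a product with one factor plus the empty
    product.\<close>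
  have "weighted_product G [(1, x)] \<in> weight_filtration 0 G (lower_central G)"
    using of by (intro weight_filtration_weighted_product) auto
  moreover have "weighted_product G [] \<in> weight_filtration 0 G (lower_central G)"
    by (intro weight_filtration_weighted_product) auto
  ultimately have "weighted_product G [(1, x)] + weighted_product G [] \<in> weight_filtration 0 G (lower_central G)"
    by (rule weight_filtration_add)
  moreover have "weighted_product G [(1, x)] + weighted_product G [] = frag_of x"
    using of by (simp add: weighted_product_def minus_one_def frag_extend_diff)
  ultimately show ?case
    by simp
qed (simp_all add: weight_filtration_0 minus_one_mult_weight_filtration del: group_ring_simps)

end


section \<open>Products of groups\<close>

lemma product_group_injection:
  assumes "\<And>k. k \<in> I \<Longrightarrow> group (P k)" "i \<in> I"
  shows "(\<lambda>g. \<lambda>k\<in>I. if k = i then g else \<one>\<^bsub>P k\<^esub>) \<in> hom (P i) (product_group I P)"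
  using assms by (auto simp: hom_def fun_eq_iff group.is_monoid)

text \<open>A finite tuple is the product of its images under the coordinate injections, each of
  which lies in the dimension subgroup by functoriality. The induction runs over the set
  \<open>J\<close> of coordinates already filled in.\<close>

lemma dimension_subgroup_product_group:
  assumes G: "\<And>k. k \<in> I \<Longrightarrow> group (P k)" and "finite I"
    and h: "\<And>k. k \<in> I \<Longrightarrow> h k \<in> dimension_subgroup m (P k)"
  shows "restrict h I \<in> dimension_subgroup m (product_group I P)"
proof -
  interpret Q: group "product_group I P"
    using G by simp
  have "(\<lambda>k\<in>I. if k \<in> J then h k else \<one>\<^bsub>P k\<^esub>) \<in> dimension_subgroup m (product_group I P)"
    if "J \<subseteq> I" for J
    using finite_subset[OF that assms(2)] that
  proof (induction J rule: finite_induct)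
    case empty
    have one: "(\<lambda>k\<in>I. if k \<in> {} then h k else \<one>\<^bsub>P k\<^esub>) = \<one>\<^bsub>product_group I P\<^esub>"
      by auto
    show ?case
      unfolding one by (rule Q.dimension_subgroup_one)
  next
    case (insert i J)
    have i: "i \<in> I"
      using insert.prems by simp
    let ?a = "\<lambda>k\<in>I. if k = i then h i else \<one>\<^bsub>P k\<^esub>"
    let ?b = "\<lambda>k\<in>I. if k \<in> J then h k else \<one>\<^bsub>P k\<^esub>"
    have "?a \<in> dimension_subgroup m (product_group I P)"
      by (rule group.dimension_subgroup_hom[OF G[OF i] Q.is_group product_group_injection[OF G i] h[OF i]])
    moreover have "?b \<in> dimension_subgroup m (product_group I P)"
      using insert.IH insert.prems by blast
    ultimately have ab: "?a \<otimes>\<^bsub>product_group I P\<^esub> ?b \<in> dimension_subgroup m (product_group I P)"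
      by (rule Q.dimension_subgroup_mult)
    have hk: "h k \<in> carrier (P k)" if "k \<in> I" for k
      using h[OF that] by (simp add: dimension_subgroup_def)
    have "?a \<otimes>\<^bsub>product_group I P\<^esub> ?b = (\<lambda>k\<in>I. if k \<in> insert i J then h k else \<one>\<^bsub>P k\<^esub>)"
      using insert.hyps hk G
      by (auto simp: fun_eq_iff group.is_monoid monoid.l_one monoid.r_one monoid.one_closed)
    then show ?case
      using ab by (simp only:)
  qed
  from this[of I] show ?thesis
    by (simp cong: restrict_cong)
qed


section \<open>The product of Tahara's groups\<close>

locale tahara_family =
  fixes P :: "nat \<Rightarrow> 'a monoid" and x1 x2 :: "nat \<Rightarrow> nat \<Rightarrow> 'a" and h :: "nat \<Rightarrow> 'a"
  assumes tahara: "\<And>k. k \<ge> 2 \<Longrightarrow> tahara_group (P k) k (x1 k) (x2 k)"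
    and h_def: "h = (\<lambda>k\<in>{2..}. x2 k 4 [^]\<^bsub>P k\<^esub> ((2::nat) ^ (k + 5)))"
begin

abbreviation \<P> :: "(nat \<Rightarrow> 'a) monoid" where
  "\<P> \<equiv> product_group {2..} P"

lemma group_P: "2 \<le> k \<Longrightarrow> group (P k)"
  using tahara tahara_group.axioms(1) by blast

sublocale Pi: group \<P>
  by (rule product_group) (simp add: group_P)

lemma inv_component:
  assumes "a \<in> carrier \<P>" "2 \<le> k"
  shows "(inv\<^bsub>\<P>\<^esub> a) k = inv\<^bsub>P k\<^esub> a k"
  using inv_product_group[of a "{2..}" P] assms group_P by simp

lemma h_component:
  assumes "2 \<le> k"
  shows "h k = tahara_group.h (P k) k (x2 k)"
  using assms tahara_group.h_def[OF tahara[OF assms]] by (simp add: h_def)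

lemma Pi_component: "a \<in> carrier \<P> \<Longrightarrow> 2 \<le> k \<Longrightarrow> a k \<in> carrier (P k)"
  by (auto simp: PiE_iff)

lemma h_closed: "h \<in> carrier \<P>"
proof -
  have "h k \<in> carrier (P k)" if "2 \<le> k" for k
    using tahara_group.h_closed[OF tahara[OF that]] h_component[OF that] by simp
  then show ?thesis
    by (auto simp: h_def PiE_iff)
qed

text \<open>In an infinite product the commutator length has to be bounded uniformly over the
  coordinates. Each \<open>h k\<close> is one triple commutator, so the coordinatewise entries form
  three tuples whose triple commutator is \<open>h\<close>.\<close>

lemma h_gamma3: "h \<in> lower_central \<P> 3"
proof -
  have "\<exists>a b c. a \<in> carrier (P k) \<and> b \<in> carrier (P k) \<and> c \<in> carrier (P k) \<and>
          h k = commutator (P k) (commutator (P k) a b) c" if k: "2 \<le> k" for k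
    using tahara_group.ex_triple_commutator[OF tahara[OF k]] h_component[OF k] by metis
  then obtain a' b' c' where abc': "\<And>k. 2 \<le> k \<Longrightarrow> a' k \<in> carrier (P k) \<and> b' k \<in> carrier (P k) \<and>
      c' k \<in> carrier (P k) \<and> h k = commutator (P k) (commutator (P k) (a' k) (b' k)) (c' k)"
    by metis
  define a b c where "a = restrict a' {2..}" "b = restrict b' {2..}" "c = restrict c' {2..}"
  note defs = this
  have abc: "a \<in> carrier \<P>" "b \<in> carrier \<P>" "c \<in> carrier \<P>"
    using abc' by (auto simp: defs)
  have comm: "commutator \<P> u v = (\<lambda>k\<in>{2..}. commutator (P k) (u k) (v k))"
    if "u \<in> carrier \<P>" "v \<in> carrier \<P>" for u v
    using inv_component[OF that(1)] inv_component[OF that(2)] by (auto simp: commutator_def fun_eq_iff)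
  have ab: "commutator \<P> a b \<in> carrier \<P>"
    using abc by (simp only: commutator_def Pi.m_closed Pi.inv_closed)
  have "commutator \<P> (commutator \<P> a b) c = h"
  proof
    fix k
    show "commutator \<P> (commutator \<P> a b) c k = h k"
    proof (cases "2 \<le> k")
      case True
      have "a k = a' k" "b k = b' k" "c k = c' k"
        using True by (simp_all add: defs)
      then show ?thesis
        unfolding comm[OF ab abc(3)] unfolding comm[OF abc(1,2)] using abc'[OF True] True by simp
    next
      \<comment> \<open>Outside the index set both sides are \<open>undefined\<close>, by the
        convention for restricted functions.\<close>
      case False
      then show ?thesis
        by (simp add: comm[OF ab abc(3)] h_def)
    qed
  qed
  then show ?thesis
    using Pi.commutator_in_gamma3[OF Pi.commutator_in_gamma2[OF abc(1,2)] abc(3)] by simp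
qed

lemma h_fin_dimension_subgroup:
  "h \<in> fin_dimension_subgroup 4 \<P> {2..} (\<lambda>j. product_group {2..j} P) (\<lambda>j x. restrict x {2..j})"
proof -
  have "restrict h {2..j} \<in> dimension_subgroup 4 (product_group {2..j} P)" for j
    using group_P tahara_group.h_dimension_subgroup[OF tahara] h_component
    by (intro dimension_subgroup_product_group) auto
  moreover have "group (product_group {2..j} P)" for j
    by (rule product_group) (simp add: group_P)
  then have "f \<in> augmentation_power (product_group {2..j} P) 4 \<Longrightarrow>
      f \<in> weight_filtration 4 (product_group {2..j} P) (lower_central (product_group {2..j} P))" for f j
    by (rule group.augmentation_power_weight_filtration)
  ultimately show ?thesis
    using h_closed
    by (simp add: fin_dimension_subgroup_def dimension_subgroup_def del: carrier_product_group)
qed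

definition represents :: "nat \<Rightarrow> (nat \<Rightarrow> int) \<Rightarrow> 'a \<Rightarrow> bool" where
  "represents k = tahara_group.represents (P k) (x1 k)"

text \<open>
  If \<open>K\<close> is large compared with \<open>k\<close>, then the coordinates \<open>v\<close> at \<open>K\<close> can be used as the auxiliary
  vector in the cubic function at \<open>k\<close>.
\<close>

definition lifts :: "nat \<Rightarrow> nat \<Rightarrow> ((nat \<Rightarrow> 'a) \<times> (nat \<Rightarrow> int) \<times> (nat \<Rightarrow> int)) set" where
  "lifts k K = {(a, n, v). a \<in> carrier \<P> \<and> represents k n (a k) \<and> represents K v (a K) \<and>
                  (\<forall>l\<in>{1..4}. 4 dvd n l - v l)}"

text \<open>The cubic function is polynomial in the triple of a tuple and its two exponent vectors.
  The triples therefore form the domain on which differences are taken before descending to the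
  first component.\<close>

definition lift_monoid :: "nat \<Rightarrow> nat \<Rightarrow> ((nat \<Rightarrow> 'a) \<times> (nat \<Rightarrow> int) \<times> (nat \<Rightarrow> int)) monoid" where
  "lift_monoid k K = (\<P> \<times>\<times> int_vectors \<times>\<times> int_vectors)\<lparr>carrier := lifts k K\<rparr>"

context
  fixes k K :: nat
  assumes k: "2 \<le> k" and K: "k + 6 \<le> K"
begin

interpretation Tk: tahara_group "P k" k "x1 k" "x2 k" "x2 k 1 [^]\<^bsub>P k\<^esub> (4::nat)" "2 ^ (k + 4)"
  using tahara[OF k] .

interpretation TK: tahara_group "P K" K "x1 K" "x2 K" "x2 K 1 [^]\<^bsub>P K\<^esub> (4::nat)" "2 ^ (K + 4)"
  using tahara[of K] k K by simp

lemma lifts_mult: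
  assumes "(a, n, v) \<in> lifts k K" "(b, m, w) \<in> lifts k K"
  shows "(a \<otimes>\<^bsub>\<P>\<^esub> b, \<lambda>i. n i + m i, \<lambda>i. v i + w i) \<in> lifts k K"
proof -
  have "(a \<otimes>\<^bsub>\<P>\<^esub> b) k = a k \<otimes>\<^bsub>P k\<^esub> b k" "(a \<otimes>\<^bsub>\<P>\<^esub> b) K = a K \<otimes>\<^bsub>P K\<^esub> b K"
    using k K by simp_all
  moreover have "4 dvd (n l + m l) - (v l + w l)" if "4 dvd n l - v l" "4 dvd m l - w l" for l
    using dvd_add[OF that] by (simp add: algebra_simps)
  ultimately show ?thesis
    using assms Pi.m_closed[of a b] Tk.represents_mult TK.represents_mult
    by (auto simp: lifts_def represents_def simp del: carrier_product_group mult_product_group)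
qed

lemma lifts_one: "(\<one>\<^bsub>\<P>\<^esub>, \<lambda>i. 0, \<lambda>i. 0) \<in> lifts k K"
  using Tk.represents_one TK.represents_one Pi.one_closed k K
  by (auto simp: lifts_def represents_def simp del: carrier_product_group)

lemma lifts_inv:
  assumes "(a, n, v) \<in> lifts k K"
  shows "(inv\<^bsub>\<P>\<^esub> a, \<lambda>i. - n i, \<lambda>i. - v i) \<in> lifts k K"
proof -
  have a: "a \<in> carrier \<P>"
    using assms by (simp add: lifts_def)
  then have "(inv\<^bsub>\<P>\<^esub> a) k = inv\<^bsub>P k\<^esub> a k" "(inv\<^bsub>\<P>\<^esub> a) K = inv\<^bsub>P K\<^esub> a K"
    using k K inv_component by simp_all
  moreover have "4 dvd - n l - - v l" if "4 dvd n l - v l" for l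
    using that by (metis dvd_minus_iff minus_diff_minus)
  ultimately show ?thesis
    using assms Pi.inv_closed[OF a] Tk.represents_inv TK.represents_inv
    by (auto simp: lifts_def represents_def simp del: carrier_product_group inv_product_group)
qed

lemma monoid_lift_monoid: "monoid (lift_monoid k K)"
proof -
  interpret D: monoid "\<P> \<times>\<times> int_vectors \<times>\<times> int_vectors"
    by (intro DirProd_monoid Pi.monoid_axioms int_vectors.monoid_axioms)
  have "submonoid (lifts k K) (\<P> \<times>\<times> int_vectors \<times>\<times> int_vectors)"
  proof
    show "lifts k K \<subseteq> carrier (\<P> \<times>\<times> int_vectors \<times>\<times> int_vectors)"
      by (auto simp: lifts_def simp del: carrier_product_group)
    show "u \<otimes>\<^bsub>\<P> \<times>\<times> int_vectors \<times>\<times> int_vectors\<^esub> w \<in> lifts k K"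
      if "u \<in> lifts k K" "w \<in> lifts k K" for u w
      using that lifts_mult by (cases u; cases w) (auto simp del: mult_product_group)
    show "\<one>\<^bsub>\<P> \<times>\<times> int_vectors \<times>\<times> int_vectors\<^esub> \<in> lifts k K"
      using lifts_one by (simp add: one_DirProd del: one_product_group)
  qed
  then show ?thesis
    unfolding lift_monoid_def by (rule submonoid.submonoid_is_monoid[OF _ D.monoid_axioms])
qed

lemma subgroup_fst_lifts: "subgroup (fst ` lifts k K) \<P>"
proof (rule Pi.subgroupI)
  show "fst ` lifts k K \<subseteq> carrier \<P>"
    by (auto simp: lifts_def simp del: carrier_product_group)
  show "fst ` lifts k K \<noteq> {}"
    using lifts_one by blast
  show "inv\<^bsub>\<P>\<^esub> a \<in> fst ` lifts k K" if "a \<in> fst ` lifts k K" for a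
    using that lifts_inv by force
  show "a \<otimes>\<^bsub>\<P>\<^esub> b \<in> fst ` lifts k K" if "a \<in> fst ` lifts k K" "b \<in> fst ` lifts k K" for a b
    using that lifts_mult by force
qed

lemma h_lifts: "(h, \<lambda>i. 0, \<lambda>i. 0) \<in> lifts k K"
  using Tk.represents_gamma2[OF Tk.h_gamma2] TK.represents_gamma2[OF TK.h_gamma2] h_closed
    h_component[of k] h_component[of K] k K
  by (simp add: lifts_def represents_def del: carrier_product_group)

text \<open>The cubic function takes the same value on all lifts of a tuple and so induces a
  function \<open>F\<close> of degree below 4 on the subgroup of tuples that have lifts. The zero
  vectors lift both \<open>h\<close> and the identity, and there \<open>F\<close> has the values
  \<open>\<chi> Tk.h\<close> and 0.\<close>

lemma h_not_in_dimension_subgroup_lifts: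
  "h \<notin> dimension_subgroup 4 (\<P>\<lparr>carrier := fst ` lifts k K\<rparr>)"
proof
  let ?S = "\<P>\<lparr>carrier := fst ` lifts k K\<rparr>"
  assume h4: "h \<in> dimension_subgroup 4 ?S"
  interpret S: group ?S
    using subgroup.subgroup_is_group[OF subgroup_fst_lifts Pi.is_group] .
  obtain \<chi> \<phi> \<psi> where "tahara_character (P k) k (x1 k) (x2 k) \<chi> \<phi> \<psi>" and \<chi>h: "\<chi> Tk.h \<noteq> 0"
    using Tk.ex_tahara_character .
  then interpret C: tahara_character "P k" k "x1 k" "x2 k" "x2 k 1 [^]\<^bsub>P k\<^esub> (4::nat)" "2 ^ (k + 4)" \<chi> \<phi> \<psi>
    by simp
  \<comment> \<open>\<open>F\<close> is defined through an arbitrary lift; the next claim shows that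
    the choice is immaterial.\<close>
  define F where "F a = (SOME t. \<exists>n v. (a, n, v) \<in> lifts k K \<and> t = C.cubic (a k) n v)" for a
  have F: "F a = C.cubic (a k) n v" if "(a, n, v) \<in> lifts k K" for a n v
  proof -
    have "\<exists>m w. (a, m, w) \<in> lifts k K \<and> F a = C.cubic (a k) m w"
      unfolding F_def by (rule someI_ex) (use that in blast)
    then obtain m w where mw: "(a, m, w) \<in> lifts k K" "F a = C.cubic (a k) m w"
      by blast
    have 4: "4 * int (Tk.d j) dvd v l - w l" if "l \<in> {1..4}" "j \<in> {1..4}" for l j
    proof -
      have "int (TK.d l) dvd v l - w l"
        using TK.represents_dvd[of w "a K" v l] mw(1) \<open>(a, n, v) \<in> lifts k K\<close> that(1)
        by (simp add: lifts_def represents_def)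
      \<comment> \<open>Source of the gap 6: at level \<open>k\<close> the largest order is
        \<open>2 ^ (k + 4)\<close>, so four times any order there divides
        \<open>2 ^ (k + 6)\<close>, while \<open>2 ^ K\<close> divides every order at level
        \<open>K\<close>.\<close>
      moreover have "(2::nat) ^ (k + 6) dvd 2 ^ K"
        using K by (rule le_imp_power_dvd)
      then have "4 * Tk.d j dvd TK.d l"
        using that unfolding in_1_4_iff by (auto simp: Tk.d_def TK.d_def power_add elim: dvd_trans[rotated])
      then have "4 * int (Tk.d j) dvd int (TK.d l)"
        by (metis of_nat_dvd_iff of_nat_mult of_nat_numeral)
      ultimately show ?thesis
        by (rule dvd_trans[rotated])
    qed
    \<comment> \<open>The auxiliary vector is exchanged first, with \<open>m\<close> fixed; since
      \<open>v\<close> and \<open>w\<close> agree modulo 4, \<open>m\<close> is still congruent to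
      \<open>v\<close>, which allows the exchange of \<open>m\<close> for \<open>n\<close>.\<close>
    have "C.cubic (a k) m w = C.cubic (a k) m v"
      using 4 by (intro C.cubic_cong_v) (simp add: dvd_diff_commute)
    also have "\<dots> = C.cubic (a k) n v"
    proof (rule C.cubic_cong_n)
      fix l :: nat assume l: "l \<in> {1..4}"
      have "4 dvd w l - v l"
        using 4[OF l l] by (simp add: dvd_diff_commute dvd_mult_left)
      moreover have "4 dvd m l - w l"
        using mw(1) l by (simp add: lifts_def)
      ultimately show "4 dvd m l - v l"
        using dvd_add by fastforce
    qed (use mw(1) that in \<open>auto simp: lifts_def represents_def\<close>)
    finally show ?thesis
      using mw(2) by simp
  qed
  have "poly_lt (lift_monoid k K) 4 (\<lambda>u. C.cubic (fst u k) (fst (snd u)) (snd (snd u)))"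
  proof (rule C.poly_lt_cubic[OF monoid_lift_monoid])
    show "(\<lambda>u. fst u k) \<in> hom (lift_monoid k K) (P k)"
      using k by (auto simp: hom_def lift_monoid_def lifts_def PiE_iff)
    show "Tk.represents (fst (snd u)) (fst u k)" if "u \<in> carrier (lift_monoid k K)" for u
      using that by (auto simp: lift_monoid_def lifts_def represents_def)
  qed (auto simp: hom_def lift_monoid_def)
  then have F4: "poly_lt (lift_monoid k K) 4 (\<lambda>u. F (fst u))"
    by (rule monoid.poly_lt_congI[OF monoid_lift_monoid]) (auto simp: lift_monoid_def F)
  have fst: "fst \<in> hom (lift_monoid k K) ?S"
    by (auto simp: hom_def lift_monoid_def)
  have "carrier ?S \<subseteq> fst ` carrier (lift_monoid k K)"
    by (simp add: lift_monoid_def)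
  then have "poly_lt ?S 4 F"
    by (rule poly_lt_descend[OF monoid_lift_monoid fst, where F = F]) (rule F4)
  then have "F h = F \<one>\<^bsub>\<P>\<^esub>"
    using S.poly_lt_dimension_subgroup[OF h4] by simp
  moreover have "F h = \<chi> Tk.h"
    using F[OF h_lifts] h_component[OF k] Tk.h_closed by (simp add: C.cubic_def Tk.word_zero)
  moreover have "F \<one>\<^bsub>\<P>\<^esub> = 0"
    using F[OF lifts_one] k C.chi_one by (simp add: C.cubic_def Tk.word_zero)
  ultimately show False
    using \<chi>h by simp
qed

end

lemma h_not_in_dimension_subgroup: "h \<notin> dimension_subgroup 4 \<P>"
proof
  assume h4: "h \<in> dimension_subgroup 4 \<P>"
  obtain W where W: "finite W" "W \<subseteq> carrier \<P>"
    "\<And>S. subgroup S \<P> \<Longrightarrow> W \<subseteq> S \<Longrightarrow> h \<in> S \<Longrightarrow> h \<in> dimension_subgroup 4 (\<P>\<lparr>carrier := S\<rparr>)"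
    using Pi.dimension_subgroup_finite_support[OF h4] by blast
  have "\<exists>n. represents k n (a k)" if "2 \<le> k" "a \<in> carrier \<P>" for k a
    unfolding represents_def
    by (rule tahara_group.ex_represents[OF tahara[OF that(1)] Pi_component[OF that(2,1)]]) (rule exI)
  then obtain N where N: "\<And>k a. 2 \<le> k \<Longrightarrow> a \<in> carrier \<P> \<Longrightarrow> represents k (N k a) (a k)"
    by metis
  \<comment> \<open>The colour of a level records the coordinates modulo 4 of all tuples in the
    finite set \<open>W\<close>, so only finitely many colours occur.\<close>
  define colour where "colour k = (\<lambda>(a, l)\<in>W \<times> {1..4::nat}. N k a l mod 4)" for k
  have "colour ` {2..} \<subseteq> W \<times> {1..4} \<rightarrow>\<^sub>E {0..<4}"
    by (auto simp: colour_def)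
  moreover have "finite (W \<times> {1..4::nat} \<rightarrow>\<^sub>E {0..<4::int})"
    using W(1) by (intro finite_PiE) auto
  ultimately have "finite (colour ` {2..})"
    by (rule finite_subset)
  then obtain k0 where k0: "k0 \<in> {2..}" "infinite {k \<in> {2..}. colour k = colour k0}"
    using pigeonhole_infinite[of "{2..}" colour] infinite_Ici by blast
  \<comment> \<open>An infinite colour class contains levels arbitrarily far beyond
    \<open>k0\<close>, in particular one with the gap required for \<open>lifts\<close>.\<close>
  then obtain K where K: "k0 + 6 \<le> K" "colour K = colour k0"
    unfolding infinite_nat_iff_unbounded_le by blast
  have "W \<subseteq> fst ` lifts k0 K"
  proof
    fix a assume a: "a \<in> W"
    have "4 dvd N k0 a l - N K a l" if "l \<in> {1..4}" for l
      using fun_cong[OF K(2)[symmetric], of "(a, l)"] a that by (simp add: colour_def mod_eq_dvd_iff)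
    then have "(a, N k0 a, N K a) \<in> lifts k0 K"
      using N a W(2) k0(1) K(1) by (auto simp: lifts_def simp del: carrier_product_group)
    then show "a \<in> fst ` lifts k0 K"
      by force
  qed
  moreover have "h \<in> fst ` lifts k0 K"
    using h_lifts[of k0 K] k0(1) K(1) by force
  ultimately have "h \<in> dimension_subgroup 4 (\<P>\<lparr>carrier := fst ` lifts k0 K\<rparr>)"
    using W(3) subgroup_fst_lifts k0(1) K(1) by simp
  then show False
    using h_not_in_dimension_subgroup_lifts k0(1) K(1) by simp
qed

end

theorem theorem8p3:
  fixes P :: "nat \<Rightarrow> 'a monoid" and x1 x2 :: "nat \<Rightarrow> nat \<Rightarrow> 'a" and h :: "nat \<Rightarrow> 'a"
  assumes tahara: "\<And>k. k \<ge> 2 \<Longrightarrow> tahara_group (P k) k (x1 k) (x2 k)"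
    and h: "h = (\<lambda>k\<in>{2..}. x2 k 4 [^]\<^bsub>P k\<^esub> ((2::nat) ^ (k + 5)))"
  shows "h \<in> (lower_central (product_group {2..} P) 3 \<inter>
              fin_dimension_subgroup 4 (product_group {2..} P)
                {2..} (\<lambda>j. product_group {2..j} P) (\<lambda>j x. restrict x {2..j}))
             - dimension_subgroup 4 (product_group {2..} P)"
proof -
  interpret tahara_family P x1 x2 h
    by (rule tahara_family.intro[OF tahara h])
  show ?thesis
    using h_gamma3 h_fin_dimension_subgroup h_not_in_dimension_subgroup by blast
qed

end
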